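(* Let $\lambda\in N$. Then $$t_{\mathrm{cut}}(\lambda)\le\mathbf{t}(\lambda)$$ in the following cases: (1) $\lambda\in N_1$ and $\mathrm{cn}\,\tau\,\mathrm{sn}\,\tau\ne0$, where $\tau=\sqrt r\left(\varphi+\frac t2\right)$ is evaluated at $t=\mathbf{t}(\lambda)$; or (2) $\lambda\in N\setminus N_1$.
   Context: Let $M=\mathbb{R}^2_{x,y}\times S^1_\theta$, $S^1=\mathbb{R}/2\pi\mathbb{Z}$, $q_0=(0,0,0)$, $N=T^*_{q_0}M$. Euler's elastic problem: for $\dot x=\cos\theta,\ \dot y=\sin\theta,\ \dot\theta=u\in\mathbb{R}$, $q(0)=q_0$, $q(t_1)=q_1$, $t_1$ fixed, $u\in L_2[0,t_1]$, minimize $J=\frac12\int_0^{t_1}u^2dt$. Covectors $\lambda\in N$ are described by $(\beta,c,r)$, $r\ge0$, $c\in\mathbb{R}$, $\beta\in S^1$: with $h_i=\langle\lambda,X_i\rangle$, $X_1=\cos\theta\,\partial_x+\sin\theta\,\partial_y$, $X_2=\partial_\theta$, $X_3=\sin\theta\,\partial_x-\cos\theta\,\partial_y$, one has $h_1=-r\cos\beta$, $h_2=c$, $h_3=-r\sin\beta$ (if $r=0$ the angle $\beta$ is irrelevant). The normal extremal trajectory $q_s=\mathrm{Exp}_s(\lambda)=(x_s,y_s,\theta_s)$ with initial covector $\lambda$ (and control $u(s)=c_s$) is the solution of $$\dot\beta=c,\quad \dot c=-r\sin\beta,\quad \dot r=0,\quad \dot x=\cos\theta,\quad \dot y=\sin\theta,\quad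 \dot\theta=c$$ with initial data $(\beta,c,r)$, $(x,y,\theta)(0)=(0,0,0)$. Cut time: $t_{\mathrm{cut}}(\lambda)=\sup\{t_1>0\mid q_s \text{ is optimal on } [0,t_1]\}\in[0,+\infty]$, where "optimal on $[0,t_1]$" means that $q_s$, $s\in[0,t_1]$, solves Euler's elastic problem with endpoints $q_0$, $q_1=q_{t_1}$ and time $t_1$. Energy $E=\frac{c^2}2-r\cos\beta$; $N=\bigcup_{i=1}^7N_i$ with $N_1=\{r\ne0,E\in(-r,r)\}$, $N_2=\{r\ne0,E>r\}$, $N_3=\{r\ne0,E=r,\beta\ne\pi\}$, $N_4=\{r\ne0,E=-r\}$, $N_5=\{r\ne0,E=r,\beta=\pi\}$, $N_6=\{r=0,c\ne0\}$, $N_7=\{r=c=0\}$. On $N_1$ use the modulus $k=\sqrt{\frac{E+r}{2r}}\in(0,1)$ and the coordinate $\varphi$ (with $\sqrt r\varphi$ mod $4K(k)$) defined by $\sin\frac\beta2=k\,\mathrm{sn}(\sqrt r\varphi,k)$, $\cos\frac\beta2=\mathrm{dn}(\sqrt r\varphi,k)$, $\frac c2=k\sqrt r\,\mathrm{cn}(\sqrt r\varphi,k)$ (representative $\beta\in(-\pi,\pi)$); on $N_2$ let $k=\sqrt{\frac{2r}{E+r}}\in(0,1)$. Jacobi functions $\mathrm{sn},\mathrm{cn}$ of $\tau$ are of modulus $k$; $K(k),E(k)$ are the complete elliptic integrals of the first and second kind. Let $k_0\in(0,1)$ be the unique root of $2E(k)-K(k)=0$, and for $k\in(0,1)$ let $p_1^1(k)$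 be the first positive root $p$ of $f_1(p,k)=\mathrm{sn}\,p\,\mathrm{dn}\,p-(2\mathrm{E}(p)-p)\,\mathrm{cn}\,p$, where $\mathrm{E}(p)=\int_0^p\mathrm{dn}^2(s,k)\,ds$. The function $\mathbf{t}:N\to(0,+\infty]$ is defined by: $\lambda\in N_1$: $\mathbf{t}(\lambda)=\frac2{\sqrt r}p_1(k)$, $p_1(k)=\min(2K(k),p_1^1(k))$ (which equals $2K(k)$ for $k\in(0,k_0]$ and $p_1^1(k)$ for $k\in[k_0,1)$); $\lambda\in N_2$: $\mathbf{t}(\lambda)=\frac{2k}{\sqrt r}K(k)$; $\lambda\in N_6$: $\mathbf{t}(\lambda)=\frac{2\pi}{|c|}$; $\lambda\in N_3\cup N_4\cup N_5\cup N_7$: $\mathbf{t}(\lambda)=+\infty$. *)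

theory Defs
  imports "HOL-Analysis.Analysis" "HOL-Library.Real_Mod"
begin

(* Jacobi elliptic functions take the modulus k, 0 < k < 1, as first argument.
   LBINT t=a..b is the oriented integral, so ell_F k is odd. *)
definition ell_F :: "real \<Rightarrow> real \<Rightarrow> real" where
  "ell_F k \<phi> = (LBINT t=ereal 0..ereal \<phi>. 1 / sqrt (1 - k\<^sup>2 * (sin t)\<^sup>2))"

definition ell_K :: "real \<Rightarrow> real" where
  "ell_K k = ell_F k (pi / 2)"

(* Jacobi amplitude: ell_F k is an increasing bijection of the real line. *)
definition jacobi_am :: "real \<Rightarrow> real \<Rightarrow> real" where
  "jacobi_am k u = (THE \<phi>. ell_F k \<phi> = u)"

definition jacobi_sn :: "real \<Rightarrow> real \<Rightarrow> real" where
  "jacobi_sn k u = sin (jacobi_am k u)"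

definition jacobi_cn :: "real \<Rightarrow> real \<Rightarrow> real" where
  "jacobi_cn k u = cos (jacobi_am k u)"

definition jacobi_dn :: "real \<Rightarrow> real \<Rightarrow> real" where
  "jacobi_dn k u = sqrt (1 - k\<^sup>2 * (jacobi_sn k u)\<^sup>2)"

definition jacobi_E :: "real \<Rightarrow> real \<Rightarrow> real" where
  "jacobi_E k p = (LBINT s=ereal 0..ereal p. (jacobi_dn k s)\<^sup>2)"

(* A configuration (x, y, \<theta>) holds a real representative of the angle; two
   configurations are the same point of M iff the angles agree modulo 2 pi. *)
type_synonym config = "real \<times> real \<times> real"

abbreviation angle :: "config \<Rightarrow> real" where
  "angle q \<equiv> snd (snd q)"

definition same_point :: "config \<Rightarrow> config \<Rightarrow> bool" where
  "same_point q q' \<longleftrightarrow>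
     fst q = fst q' \<and> fst (snd q) = fst (snd q') \<and> [angle q = angle q'] (rmod (2 * pi))"

definition L2_control :: "real \<Rightarrow> (real \<Rightarrow> real) \<Rightarrow> bool" where
  "L2_control T u \<longleftrightarrow>
     set_borel_measurable lebesgue {0..T} u \<and> set_integrable lebesgue {0..T} (\<lambda>s. (u s)\<^sup>2)"

(* Caratheodory solutions of the control system starting at q_0 = (0,0,0), in
   integral form.  The angle is the continuous lift that vanishes at time 0, so a
   curve in M has exactly one such representation. *)
definition admissible :: "real \<Rightarrow> (real \<Rightarrow> real) \<Rightarrow> (real \<Rightarrow> config) \<Rightarrow> bool" where
  "admissible T u q \<longleftrightarrow> L2_control T u \<and>
     (\<forall>t\<in>{0..T}. q t =
        ((LINT s:{0..t}|lebesgue. cos (angle (q s))),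
         (LINT s:{0..t}|lebesgue. sin (angle (q s))),
         (LINT s:{0..t}|lebesgue. u s)))"

definition elastic_energy :: "real \<Rightarrow> (real \<Rightarrow> real) \<Rightarrow> real" where
  "elastic_energy T u = (1 / 2) * (LINT s:{0..T}|lebesgue. (u s)\<^sup>2)"

definition solves_elastic_problem ::
    "real \<Rightarrow> config \<Rightarrow> (real \<Rightarrow> real) \<Rightarrow> (real \<Rightarrow> config) \<Rightarrow> bool" where
  "solves_elastic_problem T q1 u q \<longleftrightarrow>
     admissible T u q \<and> same_point (q T) q1 \<and>
     (\<forall>u' q'. admissible T u' q' \<and> same_point (q' T) q1 \<longrightarrow>
        elastic_energy T u \<le> elastic_energy T u')"

(* A covector (\<beta>, c, r), r \<ge> 0, stands for the one with h_1 = - r cos \<beta>,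
   h_2 = c, h_3 = - r sin \<beta>; \<beta> is a real representative of an angle. *)
type_synonym covector = "real \<times> real \<times> real"

definition covectors :: "covector set" where
  "covectors = {(\<beta>, c, r). r \<ge> 0}"

(* q is the trajectory Exp_s of the covector and c its control.  The vector field is
   smooth of linear growth, so c and q exist and are unique for every covector. *)
definition normal_extremal :: "covector \<Rightarrow> (real \<Rightarrow> real) \<Rightarrow> (real \<Rightarrow> config) \<Rightarrow> bool" where
  "normal_extremal l c q \<longleftrightarrow> (case l of (\<beta>0, c0, r) \<Rightarrow>
     (\<exists>\<beta> :: real \<Rightarrow> real. \<beta> 0 = \<beta>0 \<and> c 0 = c0 \<and> q 0 = (0, 0, 0) \<and>
        (\<forall>s. (\<beta> has_real_derivative c s) (at s) \<and>
             (c has_real_derivative - r * sin (\<beta> s)) (at s) \<and>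
             (q has_vector_derivative (cos (angle (q s)), sin (angle (q s)), c s)) (at s))))"

definition t_cut :: "covector \<Rightarrow> ennreal" where
  "t_cut l = Sup {ennreal t1 | t1. t1 > 0 \<and>
     (\<exists>c q. normal_extremal l c q \<and> solves_elastic_problem t1 (q t1) c q)}"

definition pend_energy :: "covector \<Rightarrow> real" where
  "pend_energy l = (case l of (\<beta>, c, r) \<Rightarrow> c\<^sup>2 / 2 - r * cos \<beta>)"

definition N1 :: "covector set" where
  "N1 = {(\<beta>, c, r). r > 0 \<and> - r < pend_energy (\<beta>, c, r) \<and> pend_energy (\<beta>, c, r) < r}"

definition N2 :: "covector set" where
  "N2 = {(\<beta>, c, r). r > 0 \<and> pend_energy (\<beta>, c, r) > r}"

definition N3 :: "covector set" where
  "N3 = {(\<beta>, c, r). r > 0 \<and> pend_energy (\<beta>, c, r) = r \<and> \<not> [\<beta> = pi] (rmod (2 * pi))}"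

definition N4 :: "covector set" where
  "N4 = {(\<beta>, c, r). r > 0 \<and> pend_energy (\<beta>, c, r) = - r}"

definition N5 :: "covector set" where
  "N5 = {(\<beta>, c, r). r > 0 \<and> pend_energy (\<beta>, c, r) = r \<and> [\<beta> = pi] (rmod (2 * pi))}"

definition N6 :: "covector set" where
  "N6 = {(\<beta>, c, r). r = 0 \<and> c \<noteq> 0}"

definition N7 :: "covector set" where
  "N7 = {(\<beta>, c, r). r = 0 \<and> c = 0}"

definition modulus1 :: "covector \<Rightarrow> real" where
  "modulus1 l = (case l of (\<beta>, c, r) \<Rightarrow> sqrt ((pend_energy l + r) / (2 * r)))"

definition modulus2 :: "covector \<Rightarrow> real" where
  "modulus2 l = (case l of (\<beta>, c, r) \<Rightarrow> sqrt (2 * r / (pend_energy l + r)))"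

(* \<phi> is a value of the elliptic coordinate of a covector in N1; it is determined
   up to multiples of 4 K(k) / sqrt r. *)
definition elliptic_coord :: "covector \<Rightarrow> real \<Rightarrow> bool" where
  "elliptic_coord l \<phi> \<longleftrightarrow> (case l of (\<beta>, c, r) \<Rightarrow>
     (\<exists>b. - pi < b \<and> b < pi \<and> [b = \<beta>] (rmod (2 * pi)) \<and>
        sin (b / 2) = modulus1 l * jacobi_sn (modulus1 l) (sqrt r * \<phi>) \<and>
        cos (b / 2) = jacobi_dn (modulus1 l) (sqrt r * \<phi>) \<and>
        c / 2 = modulus1 l * sqrt r * jacobi_cn (modulus1 l) (sqrt r * \<phi>)))"

definition f1 :: "real \<Rightarrow> real \<Rightarrow> real" where
  "f1 p k = jacobi_sn k p * jacobi_dn k p - (2 * jacobi_E k p - p) * jacobi_cn k p"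

definition p11 :: "real \<Rightarrow> real" where
  "p11 k = (LEAST p. p > 0 \<and> f1 p k = 0)"

definition p1 :: "real \<Rightarrow> real" where
  "p1 k = min (2 * ell_K k) (p11 k)"

(* The last case is the union of N3, N4, N5 and N7. *)
definition t_bound :: "covector \<Rightarrow> ennreal" where
  "t_bound l = (case l of (\<beta>, c, r) \<Rightarrow>
     if l \<in> N1 then ennreal (2 / sqrt r * p1 (modulus1 l))
     else if l \<in> N2 then ennreal (2 * modulus2 l / sqrt r * ell_K (modulus2 l))
     else if l \<in> N6 then ennreal (2 * pi / \<bar>c\<bar>)
     else \<infinity>)"

lemma covectors_partition:
  "covectors = N1 \<union> N2 \<union> N3 \<union> N4 \<union> N5 \<union> N6 \<union> N7"
proof -
  have E: "pend_energy (\<beta>, c, r) \<ge> - r" if "r \<ge> 0" for \<beta> c r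
  proof -
    have "r * cos \<beta> \<le> r * 1"
      using that by (intro mult_left_mono) auto
    moreover have "c\<^sup>2 / 2 \<ge> 0" by simp
    ultimately show ?thesis unfolding pend_energy_def prod.case by linarith
  qed
  show ?thesis
  proof (intro set_eqI)
    fix l :: covector
    obtain \<beta> c r where l: "l = (\<beta>, c, r)" by (cases l)
    show "l \<in> covectors \<longleftrightarrow> l \<in> N1 \<union> N2 \<union> N3 \<union> N4 \<union> N5 \<union> N6 \<union> N7"
      using E[of r \<beta> c]
      unfolding l covectors_def N1_def N2_def N3_def N4_def N5_def N6_def N7_def
      by (simp) linarith
  qed
qed

lemma t_bound_infinite:
  "l \<in> N3 \<union> N4 \<union> N5 \<union> N7 \<Longrightarrow> t_bound l = \<infinity>"
  by (auto simp: t_bound_def N1_def N2_def N3_def N4_def N5_def N6_def N7_def)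

end

theory Submission
  imports Defs
begin

text \<open>
  An optimal control of the elastic problem has no jump, and every case with a finite bound produces one
  that would have to jump.  Let $t$ be the claimed bound and let $c$ be the control of the given
  extremal, with heading $\theta$.  Reversing $c$ on $[0,t]$, as $\varepsilon\, c(t-s)$ with
  $\varepsilon = \pm 1$, preserves the energy, and the symmetries of the pendulum make the reversed
  curve end at the same point of $M$; thus $t$ is a Maxwell time (\<open>closed_turn_maxwell\<close>,
  \<open>symmetric_arc_maxwell\<close>).  If $c$ were optimal on $[0,T]$ with $T > t$, then the reversed
  control followed by $c$ would be optimal as well.  But it jumps at $t$ from $\varepsilon\, c(0)$ to
  $c(t)$, two different values.

  That a jump is never optimal is the Weierstrass--Erdmann corner condition
  (\<open>corner_not_optimal\<close>).  Consider the map from the space of control perturbations with zero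
  mean to (energy, $x$, $y$) of the end of the curve.  If its differential is onto, then the
  map is locally onto, so the energy can be lowered with the end point fixed.  If not, some nonzero
  covector $(\alpha_0, \alpha_1, \alpha_2)$ annihilates the differential; the du Bois-Reymond argument turns this into
  $\alpha_0 u = G + \mathrm{const}$ with $G$ continuous, so a jump forces $\alpha_0 = 0$; then the heading is constant
  and $u = 0$ on both sides of $t$, which leaves no jump (\<open>stationary_imp_no_corner\<close>).

  The Maxwell conditions are checked as follows.  When the pendulum rotates, $F(\beta/2)$ is linear
  in time ($F$ being the elliptic integral of the first kind), so at the bound $\beta$ has made one
  full turn; since $c$ never vanishes and keeps its sign, $-c(0) \neq c(t)$.  For a circle the bound is the
  time of one full turn.  When
  the pendulum oscillates, uniqueness of its solutions identifies $\beta$ with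
  $2\arcsin(k\,\mathrm{sn})$.  If $p_1 = 2K$, the time $t$ is a full period, $\theta_t = 0$ and
  $c(0) = c(t) \neq 0$ because $\mathrm{cn}\,\tau \neq 0$.  If $p_1 = p_1^1 < 2K$, then the addition
  theorems give for the component of the chord normal to the direction $\theta_t/2$ a multiple of
  $f_1(p_1)$, which is zero (\<open>inflectional_chord\<close>), so the arc shares its end with its mirror
  image in the perpendicular bisector of the chord; and $c(0) \neq c(t)$ because
  $\mathrm{sn}\,\tau \neq 0$.
\<close>

section \<open>Jacobi elliptic functions\<close>

lemma LBINT_has_real_derivative:
  fixes f :: "real \<Rightarrow> real"
  assumes "continuous_on UNIV f"
  shows "((\<lambda>x. LBINT t=ereal 0..ereal x. f t) has_real_derivative f x) (at x)"
proof -
  define m where "m = \<bar>x\<bar> + 1"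
  have "((\<lambda>u. LBINT t=ereal 0..ereal u. f t) has_vector_derivative f x) (at x within {-m..m})"
    by (rule interval_integral_FTC2) (auto simp: m_def intro: continuous_on_subset[OF assms])
  moreover have "at x within {-m..m} = at x"
    by (rule at_within_interior) (auto simp: m_def)
  ultimately show ?thesis
    by (simp add: has_real_derivative_iff_has_vector_derivative)
qed

lemma has_real_derivative_zero_imp_const:
  fixes f :: "real \<Rightarrow> real"
  assumes "\<And>x. (f has_real_derivative 0) (at x)"
  shows "f x = f y"
  using DERIV_isconst_all[of f x y] assms by blast

context
  fixes k :: real
  assumes k: "0 < k" "k < 1"
begin

lemma modulus_square_less_one: "k\<^sup>2 < 1"
  using k by (simp add: power_less_one_iff)

lemma radicand_pos: "0 < 1 - k\<^sup>2 * (sin t)\<^sup>2"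
proof -
  have "k\<^sup>2 * (sin t)\<^sup>2 \<le> k\<^sup>2 * 1"
    by (intro mult_left_mono) (auto simp: abs_square_le_1)
  then show ?thesis using modulus_square_less_one by linarith
qed

lemma ell_F_has_derivative:
  "(ell_F k has_real_derivative 1 / sqrt (1 - k\<^sup>2 * (sin x)\<^sup>2)) (at x)"
proof -
  have "continuous_on UNIV (\<lambda>t. 1 / sqrt (1 - k\<^sup>2 * (sin t)\<^sup>2))"
    using radicand_pos by (intro continuous_intros) (auto simp: less_imp_neq[symmetric])
  from LBINT_has_real_derivative[OF this, of x]
  show ?thesis by (simp add: ell_F_def[abs_def])
qed

lemma ell_F_zero [simp]: "ell_F k 0 = 0"
  by (simp add: ell_F_def)

lemma ell_F_continuous: "continuous_on S (ell_F k)"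
  using ell_F_has_derivative by (meson DERIV_isCont continuous_at_imp_continuous_on)

lemma ell_F_strict_mono: "strict_mono (ell_F k)"
proof (rule strict_monoI)
  fix x y :: real assume "x < y"
  then show "ell_F k x < ell_F k y"
    by (rule DERIV_pos_imp_increasing)
       (use ell_F_has_derivative radicand_pos in fastforce)
qed

lemma ell_F_odd: "ell_F k (- x) = - ell_F k x"
proof -
  have "((\<lambda>x. ell_F k (- x) + ell_F k x) has_real_derivative 0) (at x)" for x
    by (auto intro!: derivative_eq_intros DERIV_chain2[OF ell_F_has_derivative])
  from has_real_derivative_zero_imp_const[OF this, of x 0] show ?thesis by simp
qed

lemma ell_F_add_pi: "ell_F k (x + pi) = ell_F k x + 2 * ell_K k"
proof -
  have "((\<lambda>x. ell_F k (x + pi) - ell_F k x) has_real_derivative 0) (at x)" for x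
    by (auto intro!: derivative_eq_intros DERIV_chain2[OF ell_F_has_derivative])
  from has_real_derivative_zero_imp_const[OF this, of x "- (pi / 2)"]
  show ?thesis by (simp add: ell_K_def ell_F_odd)
qed

text \<open>
  The integrand is at least 1, so $F$ dominates the identity on the nonnegative axis; being odd, it is onto.
\<close>
lemma ell_F_ge: "0 \<le> x \<Longrightarrow> x \<le> ell_F k x"
proof -
  assume x: "0 \<le> x"
  have "ell_F k 0 - 0 \<le> ell_F k x - x"
  proof (rule DERIV_nonneg_imp_nondecreasing[OF x])
    fix y
    have "0 < sqrt (1 - k\<^sup>2 * (sin y)\<^sup>2)" "sqrt (1 - k\<^sup>2 * (sin y)\<^sup>2) \<le> 1"
      using radicand_pos by auto
    then have "0 \<le> 1 / sqrt (1 - k\<^sup>2 * (sin y)\<^sup>2) - 1" by simp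
    moreover have "((\<lambda>x. ell_F k x - x) has_real_derivative 1 / sqrt (1 - k\<^sup>2 * (sin y)\<^sup>2) - 1) (at y)"
      by (intro derivative_intros ell_F_has_derivative)
    ultimately show "\<exists>d. ((\<lambda>x. ell_F k x - x) has_real_derivative d) (at y) \<and> 0 \<le> d" by blast
  qed
  then show ?thesis by simp
qed

lemma ell_F_surj: "\<exists>x. ell_F k x = u"
proof -
  have "ell_F k (- \<bar>u\<bar>) \<le> u" "u \<le> ell_F k \<bar>u\<bar>"
    using ell_F_ge[of "\<bar>u\<bar>"] by (auto simp: ell_F_odd)
  from IVT'[OF this _ ell_F_continuous] show ?thesis by auto
qed

lemma ell_F_am [simp]: "ell_F k (jacobi_am k u) = u"
  unfolding jacobi_am_def
  by (rule theI') (metis ell_F_surj ell_F_strict_mono strict_mono_eq)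

lemma am_ell_F [simp]: "jacobi_am k (ell_F k x) = x"
  using ell_F_strict_mono strict_mono_eq ell_F_am by metis

lemma ell_K_pos: "0 < ell_K k"
  using strict_monoD[OF ell_F_strict_mono, of 0 "pi / 2"] by (simp add: ell_K_def)

lemma am_zero [simp]: "jacobi_am k 0 = 0"
  using am_ell_F[of 0] by simp

lemma am_add_2K: "jacobi_am k (u + 2 * ell_K k) = jacobi_am k u + pi"
  using ell_F_add_pi[of "jacobi_am k u"] am_ell_F ell_F_am by metis

lemma am_strict_mono: "u < v \<Longrightarrow> jacobi_am k u < jacobi_am k v"
  by (metis ell_F_am ell_F_strict_mono strict_mono_less)

lemma am_K: "jacobi_am k (ell_K k) = pi / 2"
  by (simp add: ell_K_def)

lemma dn_pos: "0 < jacobi_dn k u"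
  using radicand_pos by (simp add: jacobi_dn_def jacobi_sn_def)

lemma dn_square: "(jacobi_dn k u)\<^sup>2 = 1 - k\<^sup>2 * (jacobi_sn k u)\<^sup>2"
  using radicand_pos[of "jacobi_am k u"] by (simp add: jacobi_dn_def jacobi_sn_def)

lemma cn_square: "(jacobi_cn k u)\<^sup>2 = 1 - (jacobi_sn k u)\<^sup>2"
  by (simp add: jacobi_cn_def jacobi_sn_def cos_squared_eq)

lemma am_has_derivative: "(jacobi_am k has_real_derivative jacobi_dn k u) (at u)"
proof -
  have "(jacobi_am k has_derivative (\<lambda>h. h * jacobi_dn k u)) (at u)"
  proof (rule has_derivative_inverse_strong_x[where S = UNIV and f = "ell_F k"])
    show "(ell_F k has_derivative (\<lambda>h. h / jacobi_dn k u)) (at (jacobi_am k u))"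
      using ell_F_has_derivative[of "jacobi_am k u"]
      by (simp add: has_field_derivative_def jacobi_dn_def jacobi_sn_def mult.commute[of _ "inverse _"] divide_inverse mult_commute_abs)
    show "(\<lambda>h. h / jacobi_dn k u) \<circ> (\<lambda>h. h * jacobi_dn k u) = id"
      using dn_pos[of u] by (auto simp: fun_eq_iff)
  qed (use ell_F_continuous in auto)
  then show ?thesis by (simp add: has_field_derivative_def mult_commute_abs)
qed

lemma sn_has_derivative [derivative_intros]:
  "(jacobi_sn k has_real_derivative jacobi_cn k u * jacobi_dn k u) (at u)"
  unfolding jacobi_sn_def[abs_def] jacobi_cn_def
  by (auto intro!: derivative_eq_intros am_has_derivative)

lemma cn_has_derivative:
  "(jacobi_cn k has_real_derivative - jacobi_sn k u * jacobi_dn k u) (at u)"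
  unfolding jacobi_cn_def[abs_def] jacobi_sn_def
  by (auto intro!: derivative_eq_intros am_has_derivative)

lemma dn_has_derivative:
  "(jacobi_dn k has_real_derivative - k\<^sup>2 * jacobi_sn k u * jacobi_cn k u) (at u)"
proof -
  have "((\<lambda>u. sqrt (1 - k\<^sup>2 * (jacobi_sn k u)\<^sup>2)) has_real_derivative
     (- k\<^sup>2 * (2 * jacobi_sn k u * (jacobi_cn k u * jacobi_dn k u))) / (2 * jacobi_dn k u)) (at u)"
    using dn_pos[of u] unfolding jacobi_dn_def
    by (auto intro!: derivative_eq_intros simp: jacobi_dn_def field_simps)
  also have "(- k\<^sup>2 * (2 * jacobi_sn k u * (jacobi_cn k u * jacobi_dn k u))) / (2 * jacobi_dn k u)
    = - k\<^sup>2 * jacobi_sn k u * jacobi_cn k u"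
    using dn_pos[of u] by simp
  finally show ?thesis by (simp add: jacobi_dn_def[abs_def])
qed

lemma jacobi_E_has_derivative: "(jacobi_E k has_real_derivative (jacobi_dn k u)\<^sup>2) (at u)"
proof -
  have "continuous_on UNIV (\<lambda>s. (jacobi_dn k s)\<^sup>2)"
    using dn_has_derivative by (intro continuous_intros) (meson DERIV_isCont continuous_at_imp_continuous_on)
  from LBINT_has_real_derivative[OF this, of u] show ?thesis
    by (simp add: jacobi_E_def[abs_def])
qed

lemmas jacobi_derivatives =
  DERIV_chain2[OF sn_has_derivative] DERIV_chain2[OF cn_has_derivative]
  DERIV_chain2[OF dn_has_derivative] DERIV_chain2[OF jacobi_E_has_derivative]

lemma jacobi_zero [simp]:
  "jacobi_sn k 0 = 0" "jacobi_cn k 0 = 1" "jacobi_dn k 0 = 1" "jacobi_E k 0 = 0"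
  by (auto simp: jacobi_sn_def jacobi_cn_def jacobi_dn_def jacobi_E_def)

lemma addition_denominator_pos: "0 < 1 - k\<^sup>2 * (jacobi_sn k u)\<^sup>2 * (jacobi_sn k v)\<^sup>2"
proof -
  have "(jacobi_sn k v)\<^sup>2 \<le> 1" by (simp add: jacobi_sn_def abs_square_le_1)
  then have "k\<^sup>2 * (jacobi_sn k u)\<^sup>2 * (jacobi_sn k v)\<^sup>2 \<le> k\<^sup>2 * (jacobi_sn k u)\<^sup>2 * 1"
    by (intro mult_left_mono) auto
  then show ?thesis using radicand_pos[of "jacobi_am k u"] by (simp add: jacobi_sn_def)
qed

section \<open>Addition theorems\<close>

text \<open>
  The addition theorems are proved by letting $u$ and $v$ vary with $u + v$ fixed: the right-hand side,
  a quotient, has derivative zero, and at $v = 0$ it is the left-hand side.  Clearing denominators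
  makes the vanishing of the derivative a polynomial identity modulo the quadratic relations between
  sn, cn and dn.
\<close>
lemma quotient_const_on_line:
  fixes N D :: "real \<Rightarrow> real"
  assumes "\<And>x. (N has_real_derivative N' x) (at x)" "\<And>x. (D has_real_derivative D' x) (at x)"
    and "\<And>x. D x \<noteq> 0" "\<And>x. N' x * D x = N x * D' x"
  shows "N x / D x = N y / D y"
proof -
  have "((\<lambda>x. N x / D x) has_real_derivative 0) (at x)" for x
    using DERIV_divide[OF assms(1,2,3), of x] assms(4)[of x] by simp
  from has_real_derivative_zero_imp_const[OF this] show ?thesis .
qed

lemma addition_denominator_has_derivative:
  "((\<lambda>x. 1 - k\<^sup>2 * (jacobi_sn k x)\<^sup>2 * (jacobi_sn k (a - x))\<^sup>2) has_real_derivative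
     - 2 * k\<^sup>2 * jacobi_sn k x * jacobi_sn k (a - x) *
       (jacobi_cn k x * jacobi_dn k x * jacobi_sn k (a - x)
        - jacobi_sn k x * jacobi_cn k (a - x) * jacobi_dn k (a - x))) (at x)"
  by (auto intro!: derivative_eq_intros jacobi_derivatives simp: algebra_simps power2_eq_square)

lemma sn_add:
  "jacobi_sn k (u + v) =
     (jacobi_sn k u * jacobi_cn k v * jacobi_dn k v + jacobi_sn k v * jacobi_cn k u * jacobi_dn k u)
     / (1 - k\<^sup>2 * (jacobi_sn k u)\<^sup>2 * (jacobi_sn k v)\<^sup>2)"
proof -
  define a where "a = u + v"
  define N where "N x = jacobi_sn k x * jacobi_cn k (a - x) * jacobi_dn k (a - x)
    + jacobi_sn k (a - x) * jacobi_cn k x * jacobi_dn k x" for x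
  define D where "D x = 1 - k\<^sup>2 * (jacobi_sn k x)\<^sup>2 * (jacobi_sn k (a - x))\<^sup>2" for x
  have "N u / D u = N a / D a"
  proof (rule quotient_const_on_line)
    show "(N has_real_derivative
       jacobi_sn k x * jacobi_sn k (a - x) *
         (2 * k\<^sup>2 * ((jacobi_sn k x)\<^sup>2 - (jacobi_sn k (a - x))\<^sup>2))) (at x)" for x
    proof -
      note sq = dn_square[of x] dn_square[of "a - x"] cn_square[of x] cn_square[of "a - x"]
      show ?thesis unfolding N_def[abs_def]
        by (rule DERIV_cong, (rule derivative_eq_intros jacobi_derivatives refl)+)
           (use sq in algebra)
    qed
    show "D x \<noteq> 0" for x unfolding D_def using addition_denominator_pos[of x "a - x"] by linarith
    show "(D has_real_derivative - 2 * k\<^sup>2 * jacobi_sn k x * jacobi_sn k (a - x) *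
       (jacobi_cn k x * jacobi_dn k x * jacobi_sn k (a - x)
        - jacobi_sn k x * jacobi_cn k (a - x) * jacobi_dn k (a - x))) (at x)" for x
      unfolding D_def[abs_def] by (rule addition_denominator_has_derivative)
    show "jacobi_sn k x * jacobi_sn k (a - x) *
         (2 * k\<^sup>2 * ((jacobi_sn k x)\<^sup>2 - (jacobi_sn k (a - x))\<^sup>2)) * D x =
      N x * (- 2 * k\<^sup>2 * jacobi_sn k x * jacobi_sn k (a - x) *
       (jacobi_cn k x * jacobi_dn k x * jacobi_sn k (a - x)
        - jacobi_sn k x * jacobi_cn k (a - x) * jacobi_dn k (a - x)))" for x
      unfolding N_def D_def
      using dn_square[of x] dn_square[of "a - x"] cn_square[of x] cn_square[of "a - x"]
      by algebra
  qed
  then show ?thesis by (simp add: N_def D_def a_def)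
qed

lemma cn_add:
  "jacobi_cn k (u + v) =
     (jacobi_cn k u * jacobi_cn k v - jacobi_sn k u * jacobi_sn k v * jacobi_dn k u * jacobi_dn k v)
     / (1 - k\<^sup>2 * (jacobi_sn k u)\<^sup>2 * (jacobi_sn k v)\<^sup>2)"
proof -
  define a where "a = u + v"
  define N where "N x = jacobi_cn k x * jacobi_cn k (a - x)
    - jacobi_sn k x * jacobi_sn k (a - x) * jacobi_dn k x * jacobi_dn k (a - x)" for x
  define D where "D x = 1 - k\<^sup>2 * (jacobi_sn k x)\<^sup>2 * (jacobi_sn k (a - x))\<^sup>2" for x
  define N' where "N' x = k\<^sup>2 * (jacobi_sn k x * jacobi_cn k x * jacobi_sn k (a - x) * jacobi_sn k x * jacobi_dn k (a - x)
      - jacobi_sn k (a - x) * jacobi_cn k (a - x) * jacobi_sn k x * jacobi_sn k (a - x) * jacobi_dn k x)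
    + jacobi_cn k x * jacobi_sn k (a - x) * jacobi_dn k (a - x) * (1 - (jacobi_dn k x)\<^sup>2)
    - jacobi_cn k (a - x) * jacobi_sn k x * jacobi_dn k x * (1 - (jacobi_dn k (a - x))\<^sup>2)" for x
  have "N u / D u = N a / D a"
  proof (rule quotient_const_on_line)
    show "(N has_real_derivative N' x) (at x)" for x
      unfolding N_def[abs_def] N'_def
      by (rule DERIV_cong, (rule derivative_eq_intros jacobi_derivatives refl)+) algebra
    show "D x \<noteq> 0" for x unfolding D_def using addition_denominator_pos[of x "a - x"] by linarith
    show "(D has_real_derivative - 2 * k\<^sup>2 * jacobi_sn k x * jacobi_sn k (a - x) *
       (jacobi_cn k x * jacobi_dn k x * jacobi_sn k (a - x)
        - jacobi_sn k x * jacobi_cn k (a - x) * jacobi_dn k (a - x))) (at x)" for x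
      unfolding D_def[abs_def] by (rule addition_denominator_has_derivative)
    show "N' x * D x =
      N x * (- 2 * k\<^sup>2 * jacobi_sn k x * jacobi_sn k (a - x) *
       (jacobi_cn k x * jacobi_dn k x * jacobi_sn k (a - x)
        - jacobi_sn k x * jacobi_cn k (a - x) * jacobi_dn k (a - x)))" for x
      unfolding N_def D_def N'_def
      using dn_square[of x] dn_square[of "a - x"] cn_square[of x] cn_square[of "a - x"]
      by algebra
  qed
  then show ?thesis by (simp add: N_def D_def a_def)
qed

lemma dn_add:
  "jacobi_dn k (u + v) =
     (jacobi_dn k u * jacobi_dn k v - k\<^sup>2 * jacobi_sn k u * jacobi_sn k v * jacobi_cn k u * jacobi_cn k v)
     / (1 - k\<^sup>2 * (jacobi_sn k u)\<^sup>2 * (jacobi_sn k v)\<^sup>2)"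
proof -
  define a where "a = u + v"
  define N where "N x = jacobi_dn k x * jacobi_dn k (a - x)
    - k\<^sup>2 * jacobi_sn k x * jacobi_sn k (a - x) * jacobi_cn k x * jacobi_cn k (a - x)" for x
  define D where "D x = 1 - k\<^sup>2 * (jacobi_sn k x)\<^sup>2 * (jacobi_sn k (a - x))\<^sup>2" for x
  define N' where "N' x = k\<^sup>2 * (jacobi_sn k (a - x) * jacobi_cn k (a - x) * jacobi_dn k x
      - jacobi_sn k x * jacobi_cn k x * jacobi_dn k (a - x)
      + jacobi_sn k x * jacobi_sn k x * jacobi_dn k x * jacobi_sn k (a - x) * jacobi_cn k (a - x)
      - jacobi_sn k x * jacobi_cn k x * jacobi_sn k (a - x) * jacobi_sn k (a - x) * jacobi_dn k (a - x)
      - (jacobi_cn k x)\<^sup>2 * jacobi_dn k x * jacobi_sn k (a - x) * jacobi_cn k (a - x)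
      + (jacobi_cn k (a - x))\<^sup>2 * jacobi_dn k (a - x) * jacobi_sn k x * jacobi_cn k x)" for x
  have "N u / D u = N a / D a"
  proof (rule quotient_const_on_line)
    show "(N has_real_derivative N' x) (at x)" for x
      unfolding N_def[abs_def] N'_def
      by (rule DERIV_cong, (rule derivative_eq_intros jacobi_derivatives refl)+) algebra
    show "D x \<noteq> 0" for x unfolding D_def using addition_denominator_pos[of x "a - x"] by linarith
    show "(D has_real_derivative - 2 * k\<^sup>2 * jacobi_sn k x * jacobi_sn k (a - x) *
       (jacobi_cn k x * jacobi_dn k x * jacobi_sn k (a - x)
        - jacobi_sn k x * jacobi_cn k (a - x) * jacobi_dn k (a - x))) (at x)" for x
      unfolding D_def[abs_def] by (rule addition_denominator_has_derivative)
    show "N' x * D x =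
      N x * (- 2 * k\<^sup>2 * jacobi_sn k x * jacobi_sn k (a - x) *
       (jacobi_cn k x * jacobi_dn k x * jacobi_sn k (a - x)
        - jacobi_sn k x * jacobi_cn k (a - x) * jacobi_dn k (a - x)))" for x
      unfolding N_def D_def N'_def
      using dn_square[of x] dn_square[of "a - x"] cn_square[of x] cn_square[of "a - x"]
      by algebra
  qed
  then show ?thesis by (simp add: N_def D_def a_def)
qed

text \<open>
  The derivative along $u + v = a$ is $\mathrm{dn}^2 u - \mathrm{dn}^2 v$ minus that of the sn product;
  the addition theorem for sn makes the two equal.
\<close>
lemma jacobi_E_add:
  "jacobi_E k (u + v) = jacobi_E k u + jacobi_E k v
     - k\<^sup>2 * jacobi_sn k u * jacobi_sn k v * jacobi_sn k (u + v)"
proof -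
  define a where "a = u + v"
  define G where "G x = jacobi_E k x + jacobi_E k (a - x)
     - k\<^sup>2 * jacobi_sn k x * jacobi_sn k (a - x) * jacobi_sn k a" for x
  have "(G has_real_derivative 0) (at x)" for x
  proof -
    have "jacobi_sn k a * (1 - k\<^sup>2 * (jacobi_sn k x)\<^sup>2 * (jacobi_sn k (a - x))\<^sup>2) =
      jacobi_sn k x * jacobi_cn k (a - x) * jacobi_dn k (a - x)
      + jacobi_sn k (a - x) * jacobi_cn k x * jacobi_dn k x"
      using sn_add[of x "a - x"] addition_denominator_pos[of x "a - x"] by (simp add: field_simps)
    moreover have "1 - k\<^sup>2 * (jacobi_sn k x)\<^sup>2 * (jacobi_sn k (a - x))\<^sup>2 \<noteq> 0"
      using addition_denominator_pos[of x "a - x"] by linarith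
    ultimately have "(jacobi_dn k x)\<^sup>2 - (jacobi_dn k (a - x))\<^sup>2 =
       k\<^sup>2 * jacobi_sn k a * (jacobi_cn k x * jacobi_dn k x * jacobi_sn k (a - x)
        - jacobi_sn k x * jacobi_cn k (a - x) * jacobi_dn k (a - x))"
      using dn_square[of x] dn_square[of "a - x"] cn_square[of x] cn_square[of "a - x"]
      by algebra
    then show ?thesis
      unfolding G_def[abs_def]
      by - (rule DERIV_cong, (rule derivative_eq_intros jacobi_derivatives refl)+, algebra)
  qed
  from has_real_derivative_zero_imp_const[OF this, of u a]
  show ?thesis by (simp add: G_def a_def)
qed

lemma am_odd: "jacobi_am k (- u) = - jacobi_am k u"
  by (metis am_ell_F ell_F_am ell_F_odd)

lemma sn_odd: "jacobi_sn k (- u) = - jacobi_sn k u"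
  by (simp add: jacobi_sn_def am_odd)

lemma cn_even: "jacobi_cn k (- u) = jacobi_cn k u"
  by (simp add: jacobi_cn_def am_odd)

lemma dn_even: "jacobi_dn k (- u) = jacobi_dn k u"
  by (simp add: jacobi_dn_def sn_odd)

lemma jacobi_E_odd: "jacobi_E k (- u) = - jacobi_E k u"
  using jacobi_E_add[of u "- u"] by simp

lemma cn_diff:
  "jacobi_cn k (u + v) - jacobi_cn k (u - v) =
     - 2 * jacobi_sn k u * jacobi_dn k u * jacobi_sn k v * jacobi_dn k v
     / (1 - k\<^sup>2 * (jacobi_sn k u)\<^sup>2 * (jacobi_sn k v)\<^sup>2)"
  using cn_add[of u v] cn_add[of u "- v"]
  by (simp add: sn_odd cn_even dn_even flip: diff_divide_distrib)

text \<open>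
  Let $B/2$ be the angle with sine $k\,\mathrm{sn}$ and cosine dn, and let $M$ be the mean of the values
  of $B$ at $\tau \pm p$.  The two sides are $\cos M \int \sin B$ and $\sin M \int \cos B$ over
  $[\tau - p, \tau + p]$, so their difference is $\int \sin (B - M)$.  By the addition theorems that difference is
  $4 k\,\mathrm{sn}\,\tau\,\mathrm{dn}\,\tau\,f_1(p,k) / (1 - k^2 \mathrm{sn}^2 \tau\,\mathrm{sn}^2 p)$.
\<close>
lemma inflectional_chord:
  fixes \<tau> p :: real
  assumes "f1 p k = 0"
  defines "sm \<equiv> jacobi_sn k (\<tau> - p)" and "sp \<equiv> jacobi_sn k (\<tau> + p)"
    and "dm \<equiv> jacobi_dn k (\<tau> - p)" and "dp \<equiv> jacobi_dn k (\<tau> + p)"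
  shows "(dp * dm - k\<^sup>2 * sp * sm) * (- 2 * k * (jacobi_cn k (\<tau> + p) - jacobi_cn k (\<tau> - p)))
     = k * (sp * dm + dp * sm) * (2 * (jacobi_E k (\<tau> + p) - jacobi_E k (\<tau> - p)) - 2 * p)"
proof -
  define s where "s = jacobi_sn k \<tau>"
  define c where "c = jacobi_cn k \<tau>"
  define d where "d = jacobi_dn k \<tau>"
  define \<sigma> where "\<sigma> = jacobi_sn k p"
  define \<gamma> where "\<gamma> = jacobi_cn k p"
  define \<delta> where "\<delta> = jacobi_dn k p"
  define \<epsilon> where "\<epsilon> = jacobi_E k p"
  define D where "D = 1 - k\<^sup>2 * s\<^sup>2 * \<sigma>\<^sup>2"
  have D0: "D \<noteq> 0" using addition_denominator_pos[of \<tau> p] by (simp add: D_def s_def \<sigma>_def)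
  have sq: "c\<^sup>2 = 1 - s\<^sup>2" "d\<^sup>2 = 1 - k\<^sup>2 * s\<^sup>2" "\<gamma>\<^sup>2 = 1 - \<sigma>\<^sup>2" "\<delta>\<^sup>2 = 1 - k\<^sup>2 * \<sigma>\<^sup>2"
    by (simp_all add: s_def c_def d_def \<sigma>_def \<gamma>_def \<delta>_def dn_square cn_square)
  have f: "\<sigma> * \<delta> = (2 * \<epsilon> - p) * \<gamma>"
    using assms(1) by (simp add: f1_def \<sigma>_def \<gamma>_def \<delta>_def \<epsilon>_def)
  have sp: "sp * D = s * \<gamma> * \<delta> + \<sigma> * c * d" and sm: "sm * D = s * \<gamma> * \<delta> - \<sigma> * c * d"
    using D0 sn_add[of \<tau> p] sn_add[of \<tau> "- p"]
    by (simp_all add: sp_def sm_def D_def s_def c_def d_def \<sigma>_def \<gamma>_def \<delta>_def sn_odd cn_even dn_even)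
  have dp: "dp * D = d * \<delta> - k\<^sup>2 * s * \<sigma> * c * \<gamma>" and dm: "dm * D = d * \<delta> + k\<^sup>2 * s * \<sigma> * c * \<gamma>"
    using D0 dn_add[of \<tau> p] dn_add[of \<tau> "- p"]
    by (simp_all add: dp_def dm_def D_def s_def c_def d_def \<sigma>_def \<gamma>_def \<delta>_def sn_odd cn_even dn_even)
  have cos_mid: "(dp * dm - k\<^sup>2 * sp * sm) * D = 1 - 2 * k\<^sup>2 * s\<^sup>2 + k\<^sup>2 * s\<^sup>2 * \<sigma>\<^sup>2"
  proof -
    have "(dp * D) * (dm * D) - k\<^sup>2 * ((sp * D) * (sm * D)) = (1 - 2 * k\<^sup>2 * s\<^sup>2 + k\<^sup>2 * s\<^sup>2 * \<sigma>\<^sup>2) * D"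
      unfolding sp sm dp dm using sq D_def by algebra
    then have "((dp * dm - k\<^sup>2 * sp * sm) * D) * D = (1 - 2 * k\<^sup>2 * s\<^sup>2 + k\<^sup>2 * s\<^sup>2 * \<sigma>\<^sup>2) * D"
      by algebra
    then show ?thesis using D0 by simp
  qed
  have sin_mid: "(sp * dm + dp * sm) * D = 2 * s * d * \<gamma>"
  proof -
    have "(sp * D) * (dm * D) + (dp * D) * (sm * D) = 2 * s * d * \<gamma> * D"
      unfolding sp sm dp dm using sq D_def by algebra
    then have "((sp * dm + dp * sm) * D) * D = (2 * s * d * \<gamma>) * D"
      by algebra
    then show ?thesis using D0 by simp
  qed
  have cd: "(jacobi_cn k (\<tau> + p) - jacobi_cn k (\<tau> - p)) * D = - 2 * s * d * \<sigma> * \<delta>"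
    using D0 cn_diff[of \<tau> p] by (simp add: D_def s_def d_def \<sigma>_def \<delta>_def)
  have "jacobi_E k (\<tau> + p) - jacobi_E k (\<tau> - p) = 2 * \<epsilon> - k\<^sup>2 * s * \<sigma> * (sp + sm)"
    using jacobi_E_add[of \<tau> p] jacobi_E_add[of \<tau> "- p"]
    by (simp add: \<epsilon>_def s_def \<sigma>_def sp_def sm_def sn_odd jacobi_E_odd algebra_simps)
  then have Ed: "(jacobi_E k (\<tau> + p) - jacobi_E k (\<tau> - p)) * D = 2 * \<epsilon> * D - 2 * k\<^sup>2 * s\<^sup>2 * \<sigma> * \<gamma> * \<delta>"
    using sp sm by algebra
  have "((dp * dm - k\<^sup>2 * sp * sm) * D) * (- 2 * k * ((jacobi_cn k (\<tau> + p) - jacobi_cn k (\<tau> - p)) * D))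
    = k * ((sp * dm + dp * sm) * D) * (2 * ((jacobi_E k (\<tau> + p) - jacobi_E k (\<tau> - p)) * D) - 2 * p * D)"
    unfolding cos_mid sin_mid cd Ed using sq f D_def by algebra
  then have "((dp * dm - k\<^sup>2 * sp * sm) * (- 2 * k * (jacobi_cn k (\<tau> + p) - jacobi_cn k (\<tau> - p)))) * D\<^sup>2
    = (k * (sp * dm + dp * sm) * (2 * (jacobi_E k (\<tau> + p) - jacobi_E k (\<tau> - p)) - 2 * p)) * D\<^sup>2"
    by algebra
  moreover have "D\<^sup>2 \<noteq> 0" using D0 by simp
  ultimately show ?thesis by (rule iffD1[OF mult_right_cancel, rotated])
qed

section \<open>The first positive root of the function $f_1$\<close>

lemma f1_has_derivative:
  "((\<lambda>p. f1 p k) has_real_derivative (2 * jacobi_E k p - p) * jacobi_sn k p * jacobi_dn k p) (at p)"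
  unfolding f1_def
  using dn_square[of p] cn_square[of p]
  by - (rule DERIV_cong, (rule derivative_eq_intros jacobi_derivatives refl)+, algebra)

lemma f1_continuous: "continuous_on S (\<lambda>p. f1 p k)"
  using f1_has_derivative by (meson DERIV_isCont continuous_at_imp_continuous_on)

lemma sn_pos: "0 < p \<Longrightarrow> p < 2 * ell_K k \<Longrightarrow> 0 < jacobi_sn k p"
  using am_strict_mono[of 0 p] am_strict_mono[of p "0 + 2 * ell_K k"]
  by (simp add: am_add_2K[of 0, simplified] jacobi_sn_def sin_gt_zero)

text \<open>
  The factor $2\mathrm{E}(p) - p$ of the derivative of $f_1$ behaves like $p$ near 0, so $f_1$ increases
  from $f_1(0) = 0$.
\<close>
lemma f1_pos_near_zero: "\<exists>e>0. \<forall>p. 0 < p \<and> p < e \<longrightarrow> 0 < f1 p k"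
proof -
  have "((\<lambda>p. 2 * jacobi_E k p - p) has_real_derivative 2 * (jacobi_dn k 0)\<^sup>2 - 1) (at 0)"
    by (auto intro!: derivative_eq_intros jacobi_derivatives)
  then have "((\<lambda>p. 2 * jacobi_E k p - p) has_real_derivative 1) (at 0)" by simp
  from DERIV_pos_inc_right[OF this] obtain e0 where e0: "e0 > 0"
    "\<And>h. 0 < h \<Longrightarrow> h < e0 \<Longrightarrow> 0 < 2 * jacobi_E k h - h" by auto
  define e where "e = min e0 (2 * ell_K k)"
  have "0 < f1 p k" if p: "0 < p" "p < e" for p
  proof -
    have "f1 0 k < f1 p k"
    proof (rule DERIV_pos_imp_increasing_open[OF p(1)])
      fix x assume x: "0 < x" "x < p"
      then have "0 < (2 * jacobi_E k x - x) * jacobi_sn k x * jacobi_dn k x"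
        using p e0(2)[of x] sn_pos[of x] dn_pos by (simp add: e_def)
      with f1_has_derivative show "\<exists>y. ((\<lambda>p. f1 p k) has_real_derivative y) (at x) \<and> 0 < y" by blast
    qed (rule f1_continuous)
    then show ?thesis by (simp add: f1_def)
  qed
  moreover have "e > 0" using e0 ell_K_pos by (simp add: e_def)
  ultimately show ?thesis by blast
qed

text \<open>
  A least element of a set of reals need not exist.  Here it does: $f_1$ changes sign between $K$ and
  $3K$, because it equals dn at $K$ and $-\mathrm{dn}$ at $3K$; and its positive roots stay
  away from 0, so that those up to $3K$ form a compact set.
\<close>
lemma p11_is_root: "0 < p11 k" "f1 (p11 k) k = 0"
proof -
  obtain e where e: "e > 0" "\<And>p. 0 < p \<Longrightarrow> p < e \<Longrightarrow> 0 < f1 p k"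
    using f1_pos_near_zero by blast
  \<comment> \<open>The interval starts at $e$, below which $f_1$ has no positive root.\<close>
  define R where "R = {p \<in> {e .. max e (3 * ell_K k)}. f1 p k = 0}"
  have K3: "ell_K k + 2 * ell_K k = 3 * ell_K k" by simp
  have "0 < f1 (ell_K k) k" using dn_pos by (simp add: f1_def jacobi_sn_def jacobi_cn_def am_K)
  moreover have "f1 (3 * ell_K k) k < 0"
  proof -
    have "jacobi_am k (3 * ell_K k) = 3 / 2 * pi"
      using am_add_2K[of "ell_K k"] by (simp add: K3 am_K)
    then have "sin (jacobi_am k (3 * ell_K k)) = - 1" "cos (jacobi_am k (3 * ell_K k)) = 0"
      by (simp_all only: sin_3over2_pi cos_3over2_pi)
    then show ?thesis
      using dn_pos by (simp add: f1_def jacobi_sn_def jacobi_cn_def)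
  qed
  ultimately obtain x where x: "ell_K k \<le> x" "x \<le> 3 * ell_K k" "f1 x k = 0"
    using IVT2'[of "\<lambda>p. f1 p k" "3 * ell_K k" 0 "ell_K k", OF _ _ _ f1_continuous] ell_K_pos by auto
  then have "x \<in> R" using e(2)[of x] ell_K_pos by (force simp: R_def)
  moreover have "compact R"
  proof -
    have "R = {e .. max e (3 * ell_K k)} \<inter> (\<lambda>p. f1 p k) -` {0}" by (auto simp: R_def)
    then show ?thesis
      using continuous_closed_vimage[of "{0}" "\<lambda>p. f1 p k"] f1_continuous[of UNIV]
      by (auto simp: continuous_on_eq_continuous_at intro!: compact_Int_closed)
  qed
  ultimately obtain m where m: "m \<in> R" "\<And>y. y \<in> R \<Longrightarrow> m \<le> y"
    using compact_attains_inf[of R] by blast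
  have "p11 k = m" unfolding p11_def
  proof (rule Least_equality)
    show "0 < m \<and> f1 m k = 0" using m e by (auto simp: R_def)
    fix y assume y: "0 < y \<and> f1 y k = 0"
    then have "e \<le> y" using e(2)[of y] by force
    show "m \<le> y"
    proof (rule ccontr)
      assume "\<not> m \<le> y"
      then have "y \<in> R" using y \<open>e \<le> y\<close> m(1) by (auto simp: R_def)
      with m(2)[of y] \<open>\<not> m \<le> y\<close> show False by simp
    qed
  qed
  with m e show "0 < p11 k" "f1 (p11 k) k = 0" by (auto simp: R_def)
qed

end

section \<open>Piecewise continuous controls\<close>

text \<open>
  The pieces are continuous on the whole line, so their values at $t$ are the one-sided limits of the control.  At
  $t$ itself the control takes the left value.
\<close>
definition pw_cont :: "real \<Rightarrow> (real \<Rightarrow> real) \<Rightarrow> bool" where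
  "pw_cont t v \<longleftrightarrow> (\<exists>v1 v2. continuous_on UNIV v1 \<and> continuous_on UNIV v2 \<and>
     v = (\<lambda>s. if s \<le> t then v1 s else v2 s))"

lemma pw_contI:
  "continuous_on UNIV v1 \<Longrightarrow> continuous_on UNIV v2 \<Longrightarrow> pw_cont t (\<lambda>s. if s \<le> t then v1 s else v2 s)"
  unfolding pw_cont_def by blast

lemma continuous_imp_pw_cont: "continuous_on UNIV v \<Longrightarrow> pw_cont t v"
  using pw_contI[of v v t] by simp

lemma pw_cont_binop:
  assumes "pw_cont t v" "pw_cont t w" "continuous_on UNIV (\<lambda>p. f (fst p) (snd p))"
  shows "pw_cont t (\<lambda>s. f (v s) (w s))"
proof -
  obtain v1 v2 w1 w2 where *: "continuous_on UNIV v1" "continuous_on UNIV v2"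
    "continuous_on UNIV w1" "continuous_on UNIV w2"
    "v = (\<lambda>s. if s \<le> t then v1 s else v2 s)" "w = (\<lambda>s. if s \<le> t then w1 s else w2 s)"
    using assms(1,2) unfolding pw_cont_def by (elim exE conjE) (rule that)
  have c: "continuous_on UNIV (\<lambda>s. f (x s) (y s))"
    if "continuous_on UNIV x" "continuous_on UNIV y" for x y :: "real \<Rightarrow> real"
    using continuous_on_compose2[OF assms(3) continuous_on_Pair[OF that]] by simp
  have "(\<lambda>s. f (v s) (w s)) = (\<lambda>s. if s \<le> t then f (v1 s) (w1 s) else f (v2 s) (w2 s))"
    using * by auto
  then show ?thesis using pw_contI[OF c[OF *(1,3)] c[OF *(2,4)]] by simp
qed

lemma pw_cont_add: "pw_cont t v \<Longrightarrow> pw_cont t w \<Longrightarrow> pw_cont t (\<lambda>s. v s + w s)"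
  by (rule pw_cont_binop[where f = "(+)"]) (auto intro!: continuous_intros)

lemma pw_cont_diff: "pw_cont t v \<Longrightarrow> pw_cont t w \<Longrightarrow> pw_cont t (\<lambda>s. v s - w s)"
  by (rule pw_cont_binop[where f = "(-)"]) (auto intro!: continuous_intros)

lemma pw_cont_mult: "pw_cont t v \<Longrightarrow> pw_cont t w \<Longrightarrow> pw_cont t (\<lambda>s. v s * w s)"
  by (rule pw_cont_binop[where f = "(*)"]) (auto intro!: continuous_intros)

lemma pw_cont_const: "pw_cont t (\<lambda>s. a)"
  by (rule continuous_imp_pw_cont) (rule continuous_on_const)

lemma pw_cont_power2: "pw_cont t v \<Longrightarrow> pw_cont t (\<lambda>s. (v s)\<^sup>2)"
  using pw_cont_mult[of t v v] by (simp add: power2_eq_square)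

lemma pw_cont_borel_measurable:
  assumes "pw_cont t v" shows "v \<in> borel_measurable borel"
proof -
  obtain v1 v2 where *: "continuous_on UNIV v1" "continuous_on UNIV v2"
    "v = (\<lambda>s. if s \<le> t then v1 s else v2 s)"
    using assms(1) unfolding pw_cont_def by (elim exE conjE) (rule that)
  then have [measurable]: "v1 \<in> borel_measurable borel" "v2 \<in> borel_measurable borel"
    by (auto intro: borel_measurable_continuous_onI)
  show ?thesis unfolding *(3) by measurable
qed

lemma pw_cont_absolutely_integrable:
  assumes "pw_cont t v" shows "v absolutely_integrable_on {a..b}"
proof -
  obtain v1 v2 where *: "continuous_on UNIV v1" "continuous_on UNIV v2"
    "v = (\<lambda>s. if s \<le> t then v1 s else v2 s)"
    using assms(1) unfolding pw_cont_def by (elim exE conjE) (rule that)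
  have "(\<lambda>s. \<bar>v1 s\<bar> + \<bar>v2 s\<bar>) integrable_on {a..b}"
    using * by (intro integrable_continuous_interval continuous_intros) (auto intro: continuous_on_subset)
  moreover have "v \<in> borel_measurable (lebesgue_on {a..b})"
    using pw_cont_borel_measurable[OF assms]
    by (intro measurable_restrict_space1) (simp add: measurable_completion)
  ultimately show ?thesis
    by (intro measurable_bounded_by_integrable_imp_absolutely_integrable[where g = "\<lambda>s. \<bar>v1 s\<bar> + \<bar>v2 s\<bar>"])
       (auto simp: *(3))
qed

lemma pw_cont_integrable: "pw_cont t v \<Longrightarrow> v integrable_on {a..b}"
  by (rule set_lebesgue_integral_eq_integral(1)[OF pw_cont_absolutely_integrable])

text \<open>
  The continuous lift of the angle that starts at 0.
\<close>
definition heading :: "(real \<Rightarrow> real) \<Rightarrow> real \<Rightarrow> real" where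
  "heading v s = integral {0..s} v"

text \<open>
  The integral over an empty interval is zero, so the heading vanishes for negative times and is
  continuous on the whole line.
\<close>
lemma heading_continuous:
  assumes "pw_cont t v" shows "continuous_on UNIV (heading v)"
proof -
  have "isCont (heading v) x" for x
  proof -
    define m where "m = \<bar>x\<bar> + 1"
    have "continuous_on ({-m..0} \<union> {0..m}) (heading v)"
    proof (intro continuous_on_closed_Un)
      show "continuous_on {0..m} (heading v)" unfolding heading_def[abs_def]
        by (intro indefinite_integral_continuous_1 pw_cont_integrable[OF assms])
      have "heading v s = 0" if "s \<in> {-m..0}" for s
        using that by (cases "s = 0") (auto simp: heading_def)
      then show "continuous_on {-m..0} (heading v)"
        using continuous_on_cong[OF refl, of "{-m..0}" "heading v" "\<lambda>_. 0"] by simp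
    qed auto
    moreover have "{-m..0} \<union> {0..m} = {-m..m}" by (auto simp: m_def)
    ultimately show ?thesis
      by (intro continuous_on_interior[of "{-m..m}"]) (auto simp: m_def)
  qed
  then show ?thesis by (simp add: continuous_on_eq_continuous_at)
qed

lemma heading_zero [simp]: "heading v 0 = 0"
  by (simp add: heading_def)

lemma pw_cont_isCont:
  assumes "pw_cont t v" "s \<noteq> t" shows "isCont v s"
proof -
  obtain v1 v2 where *: "continuous_on UNIV v1" "continuous_on UNIV v2"
    "v = (\<lambda>s. if s \<le> t then v1 s else v2 s)"
    using assms(1) unfolding pw_cont_def by (elim exE conjE) (rule that)
  show ?thesis
  proof (cases "s < t")
    case True
    then have "\<forall>\<^sub>F x in nhds s. v x = v1 x"
      using eventually_nhds_in_open[of "{..<t}" s] by (auto elim!: eventually_mono simp: *(3))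
    then show ?thesis using *(1) by (subst isCont_cong) (auto simp: continuous_on_eq_continuous_at)
  next
    case False
    then have "\<forall>\<^sub>F x in nhds s. v x = v2 x"
      using assms(2) eventually_nhds_in_open[of "{t<..}" s] by (auto elim!: eventually_mono simp: *(3))
    then show ?thesis using *(2) by (subst isCont_cong) (auto simp: continuous_on_eq_continuous_at)
  qed
qed

lemma heading_has_derivative:
  assumes "pw_cont t v" "0 < s" "s \<noteq> t"
  shows "(heading v has_real_derivative v s) (at s)"
proof -
  have "((\<lambda>u. integral {0..u} v) has_vector_derivative v s) (at s within {0..s+1} - {})"
    using assms pw_cont_isCont[OF assms(1,3)]
    by (intro integral_has_vector_derivative_continuous_at pw_cont_integrable)
       (auto intro: continuous_at_imp_continuous_at_within)
  moreover have "at s within {0..s+1} - {} = at s"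
    using assms by (intro at_within_interior) auto
  ultimately show ?thesis
    by (simp add: has_real_derivative_iff_has_vector_derivative heading_def[abs_def])
qed

lemma heading_add_scaled:
  assumes "pw_cont t v" "pw_cont t w"
  shows "heading (\<lambda>s. v s + a * w s) x = heading v x + a * heading w x"
proof -
  have "pw_cont t (\<lambda>s. a * w s)" by (intro pw_cont_mult pw_cont_const assms)
  from integral_add[OF pw_cont_integrable[OF assms(1)] pw_cont_integrable[OF this], of 0 x]
  show ?thesis by (simp add: heading_def)
qed

definition trajectory :: "(real \<Rightarrow> real) \<Rightarrow> real \<Rightarrow> config" where
  "trajectory v s = (integral {0..s} (\<lambda>x. cos (heading v x)), integral {0..s} (\<lambda>x. sin (heading v x)), heading v s)"

lemma trajectory_admissible:
  assumes "pw_cont t v" shows "admissible T v (trajectory v)"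
  unfolding admissible_def
proof (intro conjI ballI)
  show "L2_control T v"
    unfolding L2_control_def
    using pw_cont_absolutely_integrable[OF assms] pw_cont_absolutely_integrable[OF pw_cont_power2[OF assms]]
    by (auto simp: set_borel_measurable_def set_integrable_def)
  fix s assume "s \<in> {0..T}"
  have "continuous_on {0..s} (heading v)" using heading_continuous[OF assms] continuous_on_subset by blast
  then have "(\<lambda>x. cos (heading v x)) absolutely_integrable_on {0..s}"
    "(\<lambda>x. sin (heading v x)) absolutely_integrable_on {0..s}"
    by (intro absolutely_integrable_continuous_real continuous_on_cos continuous_on_sin; assumption)+
  with pw_cont_absolutely_integrable[OF assms]
  show "trajectory v s =
    (LINT x:{0..s}|lebesgue. cos (angle (trajectory v x)),
     LINT x:{0..s}|lebesgue. sin (angle (trajectory v x)), LINT x:{0..s}|lebesgue. v x)"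
    by (simp add: trajectory_def set_lebesgue_integral_eq_integral heading_def)
qed

lemma elastic_energy_integral:
  "pw_cont t v \<Longrightarrow> elastic_energy T v = 1 / 2 * integral {0..T} (\<lambda>s. (v s)\<^sup>2)"
  unfolding elastic_energy_def
  by (subst set_lebesgue_integral_eq_integral(2)) (auto intro: pw_cont_absolutely_integrable pw_cont_power2)

section \<open>A corner is never optimal\<close>

lemma abs_cos_diff_le: "\<bar>cos x - cos y\<bar> \<le> \<bar>x - y\<bar>" for x y :: real
proof -
  have "\<bar>cos x - cos y\<bar> = 2 * \<bar>sin ((x + y) / 2)\<bar> * \<bar>sin ((y - x) / 2)\<bar>"
    by (simp add: cos_diff_cos abs_mult)
  also have "\<dots> \<le> 2 * 1 * \<bar>(y - x) / 2\<bar>"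
    by (intro mult_mono abs_sin_x_le_abs_x) auto
  finally show ?thesis by simp
qed

lemma abs_cos_second_order: "\<bar>cos (x + h) - cos x + h * sin x\<bar> \<le> h\<^sup>2" for x h :: real
proof -
  have "norm ((cos (x + h) + h * sin x) - (cos (x + 0) + 0 * sin x)) \<le> \<bar>h\<bar> * norm (h - 0)"
  proof (rule field_differentiable_bound[where S = "closed_segment 0 h" and f' = "\<lambda>y. sin x - sin (x + y)"])
    fix y assume y: "y \<in> closed_segment 0 h"
    show "((\<lambda>h. cos (x + h) + h * sin x) has_real_derivative sin x - sin (x + y)) (at y within closed_segment 0 h)"
      by (auto intro!: derivative_eq_intros)
    have "\<bar>sin x - sin (x + y)\<bar> = \<bar>cos (x - pi / 2) - cos (x + y - pi / 2)\<bar>"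
      by (simp add: cos_diff)
    also have "\<dots> \<le> \<bar>y\<bar>" using abs_cos_diff_le[of "x - pi / 2" "x + y - pi / 2"] by simp
    also have "\<bar>y\<bar> \<le> \<bar>h\<bar>" using y by (auto simp: closed_segment_eq_real_ivl split: if_splits)
    finally show "norm (sin x - sin (x + y)) \<le> \<bar>h\<bar>" by simp
  qed auto
  then show ?thesis by (simp add: power2_eq_square algebra_simps flip: abs_mult)
qed

text \<open>
  The remainder of the cosine is quadratic with an absolute constant, so the remainder of the integral
  is quadratic in $e$.  Replacing $\theta$ by $\theta - \pi/2$ gives the statement for the sine.
\<close>
lemma perturbed_cos_integral:
  fixes H :: "real \<Rightarrow> 'a::euclidean_space"
  assumes \<theta>: "continuous_on {0..T} \<theta>" and H: "continuous_on {0..T} H"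
  defines "X \<equiv> \<lambda>e. integral {0..T} (\<lambda>s. cos (\<theta> s + e \<bullet> H s))"
  shows "continuous_on UNIV X"
    and "(X has_derivative (\<lambda>e. integral {0..T} (\<lambda>s. - sin (\<theta> s) * (e \<bullet> H s)))) (at 0)"
proof -
  have ci: "continuous_on {0..T} (\<lambda>s. cos (\<theta> s + e \<bullet> H s))"
    "continuous_on {0..T} (\<lambda>s. - sin (\<theta> s) * (e \<bullet> H s))" "continuous_on {0..T} (\<lambda>s. cos (\<theta> s))" for e
    using \<theta> H by (auto intro!: continuous_intros)
  note int = ci[THEN integrable_continuous_interval]
  obtain C where C: "\<And>s. s \<in> {0..T} \<Longrightarrow> norm (H s) \<le> C" "C > 0"
    using compact_imp_bounded[OF compact_continuous_image[OF H]] unfolding bounded_pos by force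
  have eH: "\<bar>e \<bullet> H s\<bar> \<le> norm e * C" if "s \<in> {0..T}" for e s
    using Cauchy_Schwarz_ineq2[of e "H s"] C(1)[OF that] mult_left_mono[of "norm (H s)" C "norm e"] by simp
  have bnd: "\<bar>integral {0..T} f\<bar> \<le> M * max T 0"
    if "continuous_on {0..T} f" "\<And>s. s \<in> {0..T} \<Longrightarrow> \<bar>f s\<bar> \<le> M" for f :: "real \<Rightarrow> real" and M
    using integral_bound[of 0 T f M] that by (cases "0 \<le> T") (auto simp: max_def)
  have "(C * max T 0)-lipschitz_on UNIV X"
  proof (rule lipschitz_onI)
    fix e e' :: 'a
    have "\<bar>integral {0..T} (\<lambda>s. cos (\<theta> s + e \<bullet> H s) - cos (\<theta> s + e' \<bullet> H s))\<bar> \<le> (norm (e - e') * C) * max T 0"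
    proof (rule bnd)
      fix s assume s: "s \<in> {0..T}"
      have "\<bar>cos (\<theta> s + e \<bullet> H s) - cos (\<theta> s + e' \<bullet> H s)\<bar> \<le> \<bar>(e - e') \<bullet> H s\<bar>"
        using abs_cos_diff_le[of "\<theta> s + e \<bullet> H s" "\<theta> s + e' \<bullet> H s"] by (simp add: inner_diff_left)
      then show "\<bar>cos (\<theta> s + e \<bullet> H s) - cos (\<theta> s + e' \<bullet> H s)\<bar> \<le> norm (e - e') * C"
        using eH[OF s, of "e - e'"] by simp
    qed (intro continuous_intros ci)
    then show "dist (X e) (X e') \<le> C * max T 0 * dist e e'"
      by (simp add: X_def dist_norm integral_diff int algebra_simps)
  qed (use C in auto)
  then show "continuous_on UNIV X" by (rule lipschitz_on_continuous_on)
  define L where "L e = integral {0..T} (\<lambda>s. - sin (\<theta> s) * (e \<bullet> H s))" for e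
  have "linear L"
  proof (rule linearI)
    show "L (e + e') = L e + L e'" for e e'
      unfolding L_def by (subst integral_add[symmetric]) (use int in \<open>auto simp: algebra_simps\<close>)
    show "L (a *\<^sub>R e) = a *\<^sub>R L e" for a e
      unfolding L_def by (subst integral_cmul[symmetric]) (simp add: algebra_simps)
  qed
  have "(X has_derivative L) (at 0)"
  proof (rule has_derivativeI_sandwich[of 1])
    show "bounded_linear L" using \<open>linear L\<close> by (simp add: linear_conv_bounded_linear)
    show "((\<lambda>e. C\<^sup>2 * max T 0 * norm e) \<longlongrightarrow> 0) (at 0)"
      by (auto intro!: tendsto_eq_intros)
    fix e :: 'a assume e: "e \<noteq> 0"
    have "\<bar>integral {0..T} (\<lambda>s. cos (\<theta> s + e \<bullet> H s) - cos (\<theta> s) - (- sin (\<theta> s) * (e \<bullet> H s)))\<bar>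
      \<le> (norm e * C)\<^sup>2 * max T 0"
    proof (rule bnd)
      fix s assume s: "s \<in> {0..T}"
      have "\<bar>cos (\<theta> s + e \<bullet> H s) - cos (\<theta> s) - (- sin (\<theta> s) * (e \<bullet> H s))\<bar> \<le> \<bar>e \<bullet> H s\<bar>\<^sup>2"
        using abs_cos_second_order[of "\<theta> s" "e \<bullet> H s"] by (simp add: mult.commute)
      also have "\<dots> \<le> (norm e * C)\<^sup>2" using eH[OF s] by (intro power_mono) auto
      finally show "\<bar>cos (\<theta> s + e \<bullet> H s) - cos (\<theta> s) - (- sin (\<theta> s) * (e \<bullet> H s))\<bar> \<le> (norm e * C)\<^sup>2" .
    qed (intro continuous_on_diff ci)
    also have "integral {0..T} (\<lambda>s. cos (\<theta> s + e \<bullet> H s) - cos (\<theta> s) - (- sin (\<theta> s) * (e \<bullet> H s)))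
      = X e - X 0 - L (e - 0)"
      unfolding X_def L_def
      using integral_diff[OF integrable_diff[OF int(1)[of e] int(3)] int(2)[of e]]
        integral_diff[OF int(1)[of e] int(3)] by simp
    finally show "norm (X e - X 0 - L (e - 0)) / norm (e - 0) \<le> C\<^sup>2 * max T 0 * norm e"
      using e by (simp add: divide_le_eq power2_eq_square algebra_simps)
  qed auto
  then show "(X has_derivative (\<lambda>e. integral {0..T} (\<lambda>s. - sin (\<theta> s) * (e \<bullet> H s)))) (at 0)"
    by (simp add: L_def[abs_def])
qed

text \<open>
  The differential of (energy, $x$, $y$) at the final time $T$ in the direction $v$ of controls.
\<close>
definition first_variation :: "real \<Rightarrow> (real \<Rightarrow> real) \<Rightarrow> (real \<Rightarrow> real) \<Rightarrow> config" where
  "first_variation T u v =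
     (integral {0..T} (\<lambda>s. u s * v s),
      integral {0..T} (\<lambda>s. - sin (heading u s) * heading v s),
      integral {0..T} (\<lambda>s. cos (heading u s) * heading v s))"

lemma integral_lincomb:
  fixes f g :: "real \<Rightarrow> real"
  assumes "f integrable_on S" "g integrable_on S"
  shows "integral S (\<lambda>s. a * f s + b * g s) = a * integral S f + b * integral S g"
  using integral_add[OF integrable_on_mult_right[OF assms(1), of a] integrable_on_mult_right[OF assms(2), of b]]
  by simp

lemma first_variation_add_scaled:
  assumes "pw_cont t u" "pw_cont t v" "pw_cont t w"
  shows "first_variation T u (\<lambda>s. v s + a * w s) = first_variation T u v + a *\<^sub>R first_variation T u w"
proof -
  have c: "continuous_on {0..T} (heading x)" if "pw_cont t x" for x
    using heading_continuous[OF that] continuous_on_subset by blast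
  have i: "(\<lambda>s. u s * x s) integrable_on {0..T}"
     "(\<lambda>s. - sin (heading u s) * heading x s) integrable_on {0..T}"
     "(\<lambda>s. cos (heading u s) * heading x s) integrable_on {0..T}"
    if "pw_cont t x" for x
    by (rule pw_cont_integrable[OF pw_cont_mult[OF assms(1) that]],
        (intro integrable_continuous_interval continuous_on_mult continuous_on_minus
           continuous_on_sin continuous_on_cos c assms(1) that)+)
  note split = integral_lincomb[of _ _ _ 1 a, simplified mult_1]
  show ?thesis
    using split[OF i(1)[OF assms(2)] i(1)[OF assms(3)]]
      split[OF i(2)[OF assms(2)] i(2)[OF assms(3)]] split[OF i(3)[OF assms(2)] i(3)[OF assms(3)]]
    by (simp add: first_variation_def heading_add_scaled[OF assms(2,3)] algebra_simps)
qed

lemma heading_integration_by_parts: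
  assumes g: "continuous_on UNIV g" and v: "pw_cont t v" "heading v T = 0" and T: "0 \<le> T"
  shows "integral {0..T} (\<lambda>s. g s * heading v s) = - integral {0..T} (\<lambda>s. heading g s * v s)"
proof -
  have gp: "pw_cont t g" by (rule continuous_imp_pw_cont[OF g])
  have c: "continuous_on {0..T} (heading x)" if "pw_cont t x" for x
    using heading_continuous[OF that] continuous_on_subset by blast
  have "((\<lambda>s. g s * heading v s) has_integral integral {0..T} (\<lambda>s. g s * heading v s)) {0..T}"
    by (intro integrable_integral integrable_continuous_interval continuous_on_mult c v
        continuous_on_subset[OF g]) auto
  moreover have "((\<lambda>s. g s * heading v s) has_integral - integral {0..T} (\<lambda>s. heading g s * v s)) {0..T}"
  proof (rule integration_by_parts_interior_strong[OF bounded_bilinear_mult, where s = "{t}"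
        and f = "heading g" and g = "heading v" and g' = v])
    show "((\<lambda>s. heading g s * v s) has_integral
      heading g T * heading v T - heading g 0 * heading v 0 - - integral {0..T} (\<lambda>s. heading g s * v s)) {0..T}"
      using v(2) heading_continuous[OF gp]
      by (simp add: pw_cont_integrable[OF pw_cont_mult[OF continuous_imp_pw_cont v(1)]] integrable_integral)
  qed (use T c gp v heading_has_derivative in \<open>auto simp flip: has_real_derivative_iff_has_vector_derivative\<close>)
  ultimately show ?thesis by (simp add: has_integral_iff)
qed

lemma pw_integral_square_zero:
  fixes v1 v2 :: "real \<Rightarrow> real"
  assumes c: "continuous_on UNIV v1" "continuous_on UNIV v2" and t: "0 < t" "t < T"
    and z: "integral {0..T} (\<lambda>s. (if s \<le> t then v1 s else v2 s)\<^sup>2) = 0"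
  shows "\<forall>s\<in>{0..t}. v1 s = 0" "\<forall>s\<in>{t..T}. v2 s = 0"
proof -
  let ?v = "\<lambda>s. if s \<le> t then v1 s else v2 s"
  have i: "(\<lambda>s. (?v s)\<^sup>2) integrable_on {0..T}"
    by (rule pw_cont_integrable[OF pw_cont_power2[OF pw_contI[OF c]]])
  have "integral {0..t} (\<lambda>s. (?v s)\<^sup>2) = integral {0..t} (\<lambda>s. (v1 s)\<^sup>2)"
    by (rule integral_cong) auto
  moreover have "integral {t..T} (\<lambda>s. (?v s)\<^sup>2) = integral {t..T} (\<lambda>s. (v2 s)\<^sup>2)"
    by (rule integral_spike[where S = "{t}"]) auto
  ultimately have s: "integral {0..t} (\<lambda>s. (v1 s)\<^sup>2) + integral {t..T} (\<lambda>s. (v2 s)\<^sup>2) = 0"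
    using Henstock_Kurzweil_Integration.integral_combine[OF _ _ i, of t] t z by simp
  have co: "continuous_on {a..b} (\<lambda>s. (v1 s)\<^sup>2)" "continuous_on {a..b} (\<lambda>s. (v2 s)\<^sup>2)" for a b
    by (intro continuous_on_power continuous_on_subset[OF c(1)] continuous_on_subset[OF c(2)]; simp)+
  have "0 \<le> integral {0..t} (\<lambda>s. (v1 s)\<^sup>2)" "0 \<le> integral {t..T} (\<lambda>s. (v2 s)\<^sup>2)"
    by (intro Henstock_Kurzweil_Integration.integral_nonneg integrable_continuous_interval co; simp)+
  with s have "integral {0..t} (\<lambda>s. (v1 s)\<^sup>2) = 0" "integral {t..T} (\<lambda>s. (v2 s)\<^sup>2) = 0" by auto
  then show "\<forall>s\<in>{0..t}. v1 s = 0" "\<forall>s\<in>{t..T}. v2 s = 0"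
    using integral_eq_0_iff[OF co(1)[of 0 t]] integral_eq_0_iff[OF co(2)[of t T]] t by auto
qed

text \<open>
  The du Bois-Reymond argument.  Put $g = -b \sin\theta + c \cos\theta$ and let $G$ be its primitive.
  Integration by parts turns stationarity into orthogonality of $a u - G$ to all $v$ of zero mean.
  The choice $v = a u - G - m$, where $m$ is the mean of $a u - G$, gives $\int v^2 = 0$.
\<close>
lemma stationary_imp_no_corner:
  fixes a b c :: real
  assumes cont: "continuous_on UNIV u1" "continuous_on UNIV u2" and t: "0 < t" "t < T"
  defines "u \<equiv> \<lambda>s. if s \<le> t then u1 s else u2 s"
  assumes stat: "\<And>v. pw_cont t v \<Longrightarrow> heading v T = 0 \<Longrightarrow> (a, b, c) \<bullet> first_variation T u v = 0"
    and nz: "(a, b, c) \<noteq> 0"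
  shows "u1 t = u2 t"
proof (rule ccontr)
  assume jump: "u1 t \<noteq> u2 t"
  have u: "pw_cont t u" unfolding u_def by (rule pw_contI[OF cont])
  define \<theta> where "\<theta> = heading u"
  define g where "g s = - b * sin (\<theta> s) + c * cos (\<theta> s)" for s
  have \<theta>c: "continuous_on UNIV \<theta>" unfolding \<theta>_def by (rule heading_continuous[OF u])
  have gc: "continuous_on UNIV g" unfolding g_def[abs_def]
    by (intro continuous_on_add continuous_on_mult continuous_on_const continuous_on_sin continuous_on_cos \<theta>c)
  have gp: "pw_cont t g" by (rule continuous_imp_pw_cont[OF gc])
  have Gc: "continuous_on UNIV (heading g)" by (rule heading_continuous[OF gp])
  \<comment> \<open>The mean of $a u - G$; subtracting it makes $v$ an admissible variation.\<close>
  define m where "m = heading (\<lambda>s. a * u s - heading g s) T / T"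
  define v where "v s = a * u s - heading g s - m" for s
  have w: "pw_cont t (\<lambda>s. a * u s - heading g s)"
    by (intro pw_cont_diff pw_cont_mult pw_cont_const u continuous_imp_pw_cont Gc)
  have v: "pw_cont t v" unfolding v_def[abs_def] by (intro pw_cont_diff pw_cont_const w)
  have v0: "heading v T = 0"
    using heading_add_scaled[OF w pw_cont_const[of t 1], of "-m" T] t
    by (simp add: v_def[abs_def] m_def heading_def)
  have i: "f integrable_on {0..T}" if "pw_cont t f" for f using pw_cont_integrable[OF that] .
  have "integral {0..T} (\<lambda>s. (v s)\<^sup>2) = 0"
  proof -
    have hc: "continuous_on {0..T} (heading v)" "continuous_on {0..T} \<theta>"
      using heading_continuous[OF v] \<theta>c continuous_on_subset by blast+
    have i2: "(\<lambda>s. - sin (\<theta> s) * heading v s) integrable_on {0..T}"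
      "(\<lambda>s. cos (\<theta> s) * heading v s) integrable_on {0..T}"
      by (intro integrable_continuous_interval continuous_on_mult continuous_on_minus
          continuous_on_sin continuous_on_cos hc)+
    have "b * integral {0..T} (\<lambda>s. - sin (\<theta> s) * heading v s)
       + c * integral {0..T} (\<lambda>s. cos (\<theta> s) * heading v s)
       = integral {0..T} (\<lambda>s. b * (- sin (\<theta> s) * heading v s) + c * (cos (\<theta> s) * heading v s))"
      by (rule integral_lincomb[OF i2, symmetric])
    also have "(\<lambda>s. b * (- sin (\<theta> s) * heading v s) + c * (cos (\<theta> s) * heading v s)) = (\<lambda>s. g s * heading v s)"
      by (simp add: g_def fun_eq_iff algebra_simps)
    also have "integral {0..T} (\<lambda>s. g s * heading v s) = - integral {0..T} (\<lambda>s. heading g s * v s)"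
      using t by (intro heading_integration_by_parts[OF gc v v0]) auto
    finally have "0 = a * integral {0..T} (\<lambda>s. u s * v s) + (- 1) * integral {0..T} (\<lambda>s. heading g s * v s)"
      using stat[OF v v0] by (simp add: first_variation_def \<theta>_def)
    also have "\<dots> = integral {0..T} (\<lambda>s. a * (u s * v s) + (- 1) * (heading g s * v s))"
      by (rule integral_lincomb[OF i[OF pw_cont_mult[OF u v]]
            i[OF pw_cont_mult[OF continuous_imp_pw_cont[OF Gc] v]], symmetric])
    also have "(\<lambda>s. a * (u s * v s) + (- 1) * (heading g s * v s)) = (\<lambda>s. 1 * (v s)\<^sup>2 + m * v s)"
      by (simp add: v_def fun_eq_iff power2_eq_square algebra_simps)
    also have "integral {0..T} \<dots> = integral {0..T} (\<lambda>s. (v s)\<^sup>2)"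
      unfolding integral_lincomb[OF i[OF pw_cont_power2[OF v]] i[OF v]]
      using v0 by (simp add: heading_def)
    finally show ?thesis by simp
  qed
  also have "(\<lambda>s. (v s)\<^sup>2) = (\<lambda>s. (if s \<le> t then a * u1 s - heading g s - m else a * u2 s - heading g s - m)\<^sup>2)"
    by (auto simp: v_def u_def)
  finally have "integral {0..T} (\<lambda>s. (if s \<le> t then a * u1 s - heading g s - m else a * u2 s - heading g s - m)\<^sup>2) = 0" .
  note z = pw_integral_square_zero[OF _ _ t this]
  have "continuous_on UNIV (\<lambda>s. a * u1 s - heading g s - m)" "continuous_on UNIV (\<lambda>s. a * u2 s - heading g s - m)"
    by (intro continuous_on_diff continuous_on_mult continuous_on_const cont Gc)+
  note z = z[OF this]
  have "t \<in> {0..t}" "t \<in> {t..T}" using t by auto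
  from bspec[OF z(1) this(1)] bspec[OF z(2) this(2)] have "a * u1 t = a * u2 t" by linarith
  \<comment> \<open>The continuous function $G$ cannot absorb the jump of $u$.\<close>
  then have a: "a = 0" using jump by simp
  have hg: "heading g s = - m" if "s \<in> {0..T}" for s
    using z a that by (cases "s \<le> t") auto
  have g0: "g s = 0" if s: "0 < s" "s < T" for s
  proof -
    have "(heading g has_real_derivative 0) (at s)"
      by (rule has_field_derivative_transform_within_open[where f = "\<lambda>_. - m" and S = "{0<..<T}"])
         (use s hg in auto)
    moreover have "(heading g has_real_derivative g s) (at s)"
      by (rule heading_has_derivative[OF continuous_imp_pw_cont[OF gc] s(1), of "s + 1"]) simp
    ultimately show ?thesis using DERIV_unique by blast
  qed
  \<comment> \<open>Now $b$ and $c$ are not both 0, and $g = 0$ says that the heading is constant.\<close>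
  have u0: "u s = 0" if s: "0 < s" "s < T" "s \<noteq> t" for s
  proof -
    have d: "(\<theta> has_real_derivative u s) (at s)"
      unfolding \<theta>_def by (rule heading_has_derivative[OF u s(1,3)])
    have "(g has_real_derivative (- b * cos (\<theta> s) - c * sin (\<theta> s)) * u s) (at s)"
      unfolding g_def[abs_def] by (auto intro!: derivative_eq_intros d simp: algebra_simps)
    moreover have "(g has_real_derivative 0) (at s)"
      by (rule has_field_derivative_transform_within_open[where f = "\<lambda>_. 0" and S = "{0<..<T}"])
         (use s g0 in auto)
    ultimately have "(- b * cos (\<theta> s) - c * sin (\<theta> s)) * u s = 0" using DERIV_unique by blast
    moreover have "(- b * cos (\<theta> s) - c * sin (\<theta> s))\<^sup>2 + (g s)\<^sup>2 = b\<^sup>2 + c\<^sup>2"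
      using sin_cos_squared_add[of "\<theta> s"] unfolding g_def by algebra
    moreover have "b\<^sup>2 + c\<^sup>2 \<noteq> 0" using nz a by (auto simp: sum_power2_eq_zero_iff zero_prod_def)
    ultimately show ?thesis using g0[OF s(1,2)] by auto
  qed
  have "u1 t = 0"
  proof (rule continuous_constant_on_closure[of "{0<..<t}" u1 0 t])
    show "continuous_on (closure {0<..<t}) u1" by (rule continuous_on_subset[OF cont(1)]) simp
    show "u1 s = 0" if "s \<in> {0<..<t}" for s using u0[of s] that t by (simp add: u_def)
  qed (use t in simp)
  moreover have "u2 t = 0"
  proof (rule continuous_constant_on_closure[of "{t<..<T}" u2 0 t])
    show "continuous_on (closure {t<..<T}) u2" by (rule continuous_on_subset[OF cont(2)]) simp
    show "u2 s = 0" if "s \<in> {t<..<T}" for s using u0[of s] that t by (simp add: u_def)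
  qed (use t in simp)
  ultimately show False using jump by simp
qed

text \<open>
  Three perturbations whose first variations are the unit vectors span a family of controls on which
  (energy, $x$, $y$) has the identity as its differential at $0$.  Such a map is open at $0$, so it takes a
  value with smaller energy and the same $x$ and $y$; the zero mean of the perturbations keeps the final angle.
\<close>
lemma corner_not_optimal:
  assumes cont: "continuous_on UNIV u1" "continuous_on UNIV u2" and t: "0 < t" "t < T"
    and jump: "u1 t \<noteq> u2 t"
  defines "u \<equiv> \<lambda>s. if s \<le> t then u1 s else u2 s"
  obtains w where "pw_cont t w" "trajectory w T = trajectory u T"
    "elastic_energy T w < elastic_energy T u"
proof -
  have u: "pw_cont t u" unfolding u_def by (rule pw_contI[OF cont])
  define V where "V = {v. pw_cont t v \<and> heading v T = 0}"
  \<comment> \<open>$R$ is a subspace; if proper, it has a nonzero orthogonal covector.\<close>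
  define R where "R = first_variation T u ` V"
  have V0: "(\<lambda>_. 0) \<in> V" by (simp add: V_def pw_cont_const heading_def)
  have EV0: "first_variation T u (\<lambda>_. 0) = 0"
    by (simp add: first_variation_def heading_def zero_prod_def)
  have Vlin: "(\<lambda>s. v s + a * w s) \<in> V" if "v \<in> V" "w \<in> V" for v w a
    using that heading_add_scaled[of t v w a T] by (auto simp: V_def intro!: pw_cont_add pw_cont_mult pw_cont_const)
  have EVlin: "first_variation T u (\<lambda>s. v s + a * w s) = first_variation T u v + a *\<^sub>R first_variation T u w"
    if "v \<in> V" "w \<in> V" for v w a
    using that by (intro first_variation_add_scaled[OF u]) (auto simp: V_def)
  have R: "R = UNIV"
  proof -
    have lin: "x + a *\<^sub>R y \<in> R" if xy: "x \<in> R" "y \<in> R" for x y a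
    proof -
      obtain v w where vw: "v \<in> V" "w \<in> V" "x = first_variation T u v" "y = first_variation T u w"
        using xy unfolding R_def by (elim imageE) (rule that)
      show ?thesis unfolding R_def vw(3,4) EVlin[OF vw(1,2), symmetric] by (rule imageI[OF Vlin[OF vw(1,2)]])
    qed
    have R0: "0 \<in> R" using imageI[OF V0, of "first_variation T u"] by (simp add: R_def EV0)
    have "subspace R"
      unfolding subspace_def using R0 lin[of _ _ 1] lin[OF R0] by auto
    moreover have "span R = UNIV"
    proof (rule ccontr)
      assume "span R \<noteq> UNIV"
      then have "dim R < DIM(config)" using dim_eq_full dim_subset_UNIV le_neq_implies_less by blast
      from orthogonal_to_subspace_exists[OF this] obtain x :: config
        where x: "x \<noteq> 0" "\<And>y. y \<in> span R \<Longrightarrow> orthogonal x y" by blast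
      obtain a b c where abc: "x = (a, b, c)" by (cases x)
      have "u1 t = u2 t"
      proof (rule stationary_imp_no_corner[OF cont t])
        show "(a, b, c) \<noteq> 0" using x(1) abc by simp
        fix v assume "pw_cont t v" "heading v T = 0"
        then have "first_variation T u v \<in> span R" by (intro span_base) (simp add: R_def V_def)
        from x(2)[OF this] show "(a, b, c) \<bullet> first_variation T (\<lambda>s. if s \<le> t then u1 s else u2 s) v = 0"
          by (simp add: orthogonal_def abc u_def)
      qed
      with jump show False by simp
    qed
    ultimately show ?thesis using span_eq_iff by blast
  qed
  have attained: "\<exists>v\<in>V. first_variation T u v = x" for x
  proof -
    have "x \<in> first_variation T u ` V" using UNIV_I R unfolding R_def by (rule ssubst[rotated])
    then show ?thesis by (rule imageE) (rule bexI, rule sym)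
  qed
  obtain v1 where v1: "v1 \<in> V" "first_variation T u v1 = (1, 0, 0)" using attained by blast
  obtain v2 where v2: "v2 \<in> V" "first_variation T u v2 = (0, 1, 0)" using attained by blast
  obtain v3 where v3: "v3 \<in> V" "first_variation T u v3 = (0, 0, 1)" using attained by blast
  note vV = v1(1) v2(1) v3(1) and EV = v1(2) v2(2) v3(2)
  \<comment> \<open>The summand 0 here and the factor 1 below bring the sums into the form $v + a w$ of the linearity facts.\<close>
  define vv where "vv e = (\<lambda>s. ((0 + fst e * v1 s) + fst (snd e) * v2 s) + snd (snd e) * v3 s)" for e :: config
  define H where "H s = (heading v1 s, heading v2 s, heading v3 s)" for s
  have vvV: "vv e \<in> V" for e unfolding vv_def by (intro Vlin V0 vV)
  have pw: "pw_cont t v1" "pw_cont t v2" "pw_cont t v3" "pw_cont t (vv e)" for e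
    using vV vvV[of e] by (auto simp: V_def)
  have EVvv: "first_variation T u (vv e) = e" for e
    unfolding vv_def using V0 vV EV EV0
    by (subst EVlin Vlin; (intro Vlin V0 vV)?)+ simp
  have hvv: "heading (vv e) s = e \<bullet> H s" for e s
    unfolding vv_def
    by (subst heading_add_scaled[of t], (intro pw pw_cont_add pw_cont_mult pw_cont_const)+)+
       (simp add: H_def heading_def inner_prod_def)
  define w where "w e = (\<lambda>s. u s + 1 * vv e s)" for e
  have w: "pw_cont t (w e)" for e
    unfolding w_def by (intro pw_cont_add pw_cont_mult pw_cont_const u pw)
  have hw: "heading (w e) s = heading u s + e \<bullet> H s" for e s
    unfolding w_def heading_add_scaled[OF u pw(4)] hvv by simp
  have c: "continuous_on {0..T} (heading x)" if "pw_cont t x" for x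
    using heading_continuous[OF that] continuous_on_subset by blast
  have Hc: "continuous_on {0..T} H" unfolding H_def by (intro continuous_on_Pair c pw)
  have \<theta>c: "continuous_on {0..T} (\<lambda>s. heading u s - pi / 2)" by (intro continuous_on_diff continuous_on_const c u)
  define J where "J x y = integral {0..T} (\<lambda>s. x s * y s)" for x y :: "real \<Rightarrow> real"
  have J_lin: "J (\<lambda>s. x s + a * y s) z = J x z + a * J y z"
    if "pw_cont t x" "pw_cont t y" "pw_cont t z" for x y z a
    using integral_lincomb[OF pw_cont_integrable[OF pw_cont_mult[OF that(1,3)]]
        pw_cont_integrable[OF pw_cont_mult[OF that(2,3)]], of 0 T 1 a]
    by (simp add: J_def algebra_simps)
  have J_sym: "J x y = J y x" for x y by (simp add: J_def mult.commute)
  have Juv: "J u (vv e) = fst e" for e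
    using arg_cong[OF EVvv[of e], of fst] by (simp add: first_variation_def J_def)
  have Jvv: "J (vv e) y = fst e * J v1 y + fst (snd e) * J v2 y + snd (snd e) * J v3 y" if "pw_cont t y" for e y
    unfolding vv_def
    by (subst J_lin, (intro pw that pw_cont_add pw_cont_mult pw_cont_const)+)+ (simp add: J_def)
  define E where "E e = 1 / 2 * J (w e) (w e)" for e
  have E: "E e = 1 / 2 * J u u + fst e + 1 / 2 * J (vv e) (vv e)" for e
  proof -
    have "J (w e) y = J u y + 1 * J (vv e) y" if "pw_cont t y" for y
      unfolding w_def by (rule J_lin[OF u pw(4) that])
    from this[OF w] this[OF u] this[OF pw(4), of e]
    show ?thesis by (simp add: E_def J_sym[of u "w e"] J_sym[of "vv e" "w e"] Juv J_sym[of "vv e" u] algebra_simps)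
  qed
  have E': "E e = 1 / 2 * J u u + fst e + 1 / 2 *
      (fst e * (fst e * J v1 v1 + fst (snd e) * J v2 v1 + snd (snd e) * J v3 v1)
     + fst (snd e) * (fst e * J v1 v2 + fst (snd e) * J v2 v2 + snd (snd e) * J v3 v2)
     + snd (snd e) * (fst e * J v1 v3 + fst (snd e) * J v2 v3 + snd (snd e) * J v3 v3))" for e
    unfolding E Jvv[OF pw(4)] J_sym[of v1 "vv e"] J_sym[of v2 "vv e"] J_sym[of v3 "vv e"]
      Jvv[OF pw(1)] Jvv[OF pw(2)] Jvv[OF pw(3)] by simp
  have Ec: "continuous_on UNIV E" unfolding E'[abs_def] by (intro continuous_intros)
  have Ed: "(E has_derivative fst) (at 0)"
    unfolding E'[abs_def] by (rule has_derivative_eq_rhs, (rule derivative_eq_intros refl)+) (auto simp: fun_eq_iff)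
  define X where "X e = integral {0..T} (\<lambda>s. cos (heading u s + e \<bullet> H s))" for e
  define Y where "Y e = integral {0..T} (\<lambda>s. cos (heading u s - pi / 2 + e \<bullet> H s))" for e
  have Xc: "continuous_on UNIV X" and Xd: "(X has_derivative (\<lambda>e. fst (snd e))) (at 0)"
  proof -
    have "(\<lambda>e. integral {0..T} (\<lambda>s. - sin (heading u s) * (e \<bullet> H s))) = (\<lambda>e. fst (snd e))"
      using arg_cong[OF EVvv, of "\<lambda>x. fst (snd x)"] by (simp add: first_variation_def hvv)
    with perturbed_cos_integral[OF c[OF u] Hc]
    show "continuous_on UNIV X" "(X has_derivative (\<lambda>e. fst (snd e))) (at 0)" by (simp_all add: X_def[abs_def])
  qed
  have Yc: "continuous_on UNIV Y" and Yd: "(Y has_derivative (\<lambda>e. snd (snd e))) (at 0)"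
  proof -
    have "(\<lambda>e. integral {0..T} (\<lambda>s. - sin (heading u s - pi / 2) * (e \<bullet> H s))) = (\<lambda>e. snd (snd e))"
      using arg_cong[OF EVvv, of "\<lambda>x. snd (snd x)"] by (simp add: first_variation_def hvv sin_diff)
    with perturbed_cos_integral[OF \<theta>c Hc]
    show "continuous_on UNIV Y" "(Y has_derivative (\<lambda>e. snd (snd e))) (at 0)" by (simp_all add: Y_def[abs_def])
  qed
  define F where "F e = (E e, X e, Y e)" for e
  have "F 0 \<in> interior (F ` UNIV)"
  proof (rule sussmann_open_mapping)
    show "continuous_on UNIV F" unfolding F_def by (intro continuous_on_Pair Ec Xc Yc)
    show "(F has_derivative (\<lambda>e. (fst e, fst (snd e), snd (snd e)))) (at 0)"
      unfolding F_def by (intro has_derivative_Pair Ed Xd Yd)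
  qed (auto intro: bounded_linear_ident)
  then obtain d where d: "d > 0" "ball (F 0) d \<subseteq> range F" by (auto simp: mem_interior)
  \<comment> \<open>Lower the energy and keep the end point.\<close>
  have "F 0 - (d / 2, 0, 0) \<in> ball (F 0) d" using d(1) by (simp add: dist_norm norm_Pair)
  with d(2) obtain e where e: "F e = F 0 - (d / 2, 0, 0)" by (metis imageE subsetD)
  have F0: "F 0 = (1 / 2 * J u u, X 0, Y 0)" by (simp add: F_def E')
  show thesis
  proof (rule that[OF w[of e]])
    have XY: "X e = X 0" "Y e = Y 0" and "E e < 1 / 2 * J u u"
      using e d(1) by (simp_all add: F_def E'[of 0])
    then show "elastic_energy T (w e) < elastic_energy T u"
      by (simp add: elastic_energy_integral[OF w] elastic_energy_integral[OF u] E_def J_def power2_eq_square)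
    have "H T = 0" using vV by (simp add: H_def V_def zero_prod_def)
    moreover have "cos (x - pi / 2 + y) = sin (x + y)" for x y :: real
      using cos_diff[of "x + y" "pi / 2"] by (simp add: algebra_simps)
    then have "Y e = integral {0..T} (\<lambda>s. sin (heading u s + e \<bullet> H s))" for e
      by (simp only: Y_def)
    ultimately show "trajectory (w e) T = trajectory u T"
      using XY by (simp add: trajectory_def hw X_def)
  qed
qed

section \<open>Maxwell points end optimality\<close>

lemma continuous_heading:
  assumes "continuous_on UNIV c"
  shows "continuous_on S (heading c)"
  using heading_continuous[OF continuous_imp_pw_cont[OF assms]] continuous_on_subset by blast

lemma admissible_imp_trajectory:
  assumes c: "continuous_on UNIV c" and q: "admissible T c q" and s: "s \<in> {0..T}"
  shows "q s = trajectory c s"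
proof -
  have "c absolutely_integrable_on {0..x}" for x
    by (rule pw_cont_absolutely_integrable[OF continuous_imp_pw_cont[OF c]])
  then have h: "(LINT y:{0..x}|lebesgue. c y) = heading c x" for x
    by (simp add: heading_def set_lebesgue_integral_eq_integral)
  have a: "angle (q x) = heading c x" if "x \<in> {0..T}" for x
    using q that by (simp add: admissible_def h)
  have "(LINT x:{0..s}|lebesgue. cos (angle (q x))) = (LINT x:{0..s}|lebesgue. cos (heading c x))"
    "(LINT x:{0..s}|lebesgue. sin (angle (q x))) = (LINT x:{0..s}|lebesgue. sin (heading c x))"
    using s by (auto intro!: set_lebesgue_integral_cong simp: a)
  moreover have "(\<lambda>x. cos (heading c x)) absolutely_integrable_on {0..s}"
    "(\<lambda>x. sin (heading c x)) absolutely_integrable_on {0..s}"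
    by (intro absolutely_integrable_continuous_real continuous_on_cos continuous_on_sin
        continuous_heading c)+
  ultimately show ?thesis
    using q s by (simp add: admissible_def h trajectory_def set_lebesgue_integral_eq_integral)
qed

text \<open>
  If $b$ reaches the point of $c$ at time $t$ with the same energy, then following $b$ up to $t$ and $c$ afterwards
  costs as much as $c$ and ends at the same point: headings that differ by a multiple of
  $2\pi$ at time $t$ give the same motion from there on.  This concatenation has a corner at $t$.
\<close>
lemma maxwell_point_ends_optimality:
  assumes c: "continuous_on UNIV c" and b: "continuous_on UNIV b" and t: "0 < t" "t < T"
    and energy: "integral {0..t} (\<lambda>s. (b s)\<^sup>2) = integral {0..t} (\<lambda>s. (c s)\<^sup>2)"
    and x: "integral {0..t} (\<lambda>s. cos (heading b s)) = integral {0..t} (\<lambda>s. cos (heading c s))"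
    and y: "integral {0..t} (\<lambda>s. sin (heading b s)) = integral {0..t} (\<lambda>s. sin (heading c s))"
    and angle: "heading b t = heading c t + 2 * pi * of_int n"
    and jump: "b t \<noteq> c t"
  shows "\<not> solves_elastic_problem T q1 c q"
proof
  assume opt: "solves_elastic_problem T q1 c q"
  define u where "u = (\<lambda>s. if s \<le> t then b s else c s)"
  have u: "pw_cont t u" unfolding u_def by (rule pw_contI[OF b c])
  have cp: "pw_cont t c" by (rule continuous_imp_pw_cont[OF c])
  have comb: "integral {0..s} f = integral {0..t} f + integral {t..s} f"
    if "f integrable_on {0..s}" "t \<le> s" for f :: "real \<Rightarrow> real" and s
    using Henstock_Kurzweil_Integration.integral_combine[OF _ that(2,1)] t by simp
  have early: "heading u s = heading b s" if "s \<le> t" for s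
    unfolding heading_def by (rule integral_cong) (use that in \<open>simp add: u_def\<close>)
  have late: "heading u s = heading c s + 2 * pi * of_int n" if "t \<le> s" for s
  proof -
    have "integral {t..s} u = integral {t..s} c"
      by (rule integral_spike[where S = "{t}"]) (auto simp: u_def)
    then show ?thesis
      using comb[OF pw_cont_integrable[OF u] that] comb[OF pw_cont_integrable[OF cp] that] early[of t] angle
      by (simp add: heading_def)
  qed
  have split: "integral {0..T} f = integral {0..T} g"
    if "f integrable_on {0..T}" "g integrable_on {0..T}" "integral {0..t} f = integral {0..t} g"
      "\<And>s. t < s \<Longrightarrow> f s = g s" for f g :: "real \<Rightarrow> real"
  proof -
    have "integral {t..T} f = integral {t..T} g"
      by (rule integral_spike[where S = "{t}"]) (use that(4) in auto)
    then show ?thesis using comb[OF that(1)] comb[OF that(2)] that(3) t by simp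
  qed
  have int: "(\<lambda>s. cos (heading v s)) integrable_on {0..T}" "(\<lambda>s. sin (heading v s)) integrable_on {0..T}"
    if "pw_cont t v" for v
    by (intro integrable_continuous_interval continuous_on_cos continuous_on_sin
        continuous_on_subset[OF heading_continuous[OF that]]; simp)+
  have periodic: "cos (heading u s) = cos (heading c s)" "sin (heading u s) = sin (heading c s)" if "t < s" for s
    using late[of s] that sin_cos_eq_iff[of "heading u s" "heading c s"] by auto
  have e1: "integral {0..t} (\<lambda>s. cos (heading u s)) = integral {0..t} (\<lambda>s. cos (heading b s))"
    by (rule integral_cong) (simp add: early)
  have e2: "integral {0..t} (\<lambda>s. sin (heading u s)) = integral {0..t} (\<lambda>s. sin (heading b s))"
    by (rule integral_cong) (simp add: early)
  have e3: "integral {0..t} (\<lambda>s. (u s)\<^sup>2) = integral {0..t} (\<lambda>s. (b s)\<^sup>2)"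
    by (rule integral_cong) (simp add: u_def)
  note early_integrals = e1 e2 e3
  have X: "integral {0..T} (\<lambda>s. cos (heading u s)) = integral {0..T} (\<lambda>s. cos (heading c s))"
    by (rule split[OF int(1)[OF u] int(1)[OF cp]]) (simp_all add: early_integrals x periodic)
  have Y: "integral {0..T} (\<lambda>s. sin (heading u s)) = integral {0..T} (\<lambda>s. sin (heading c s))"
    by (rule split[OF int(2)[OF u] int(2)[OF cp]]) (simp_all add: early_integrals y periodic)
  have E: "elastic_energy T u = elastic_energy T c"
    unfolding elastic_energy_integral[OF u] elastic_energy_integral[OF cp]
    using split[OF pw_cont_integrable[OF pw_cont_power2[OF u]] pw_cont_integrable[OF pw_cont_power2[OF cp]]]
    by (simp add: e3 energy) (simp add: u_def)
  obtain w where w: "pw_cont t w" "trajectory w T = trajectory u T" "elastic_energy T w < elastic_energy T u"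
    using corner_not_optimal[OF b c t jump] unfolding u_def by blast
  have "q T = trajectory c T"
    using opt t by (intro admissible_imp_trajectory[OF c]) (auto simp: solves_elastic_problem_def)
  moreover have "same_point (trajectory u T) (trajectory c T)"
    using X Y late[of T] t
    by (auto simp: same_point_def trajectory_def rcong_altdef algebra_simps intro!: exI[of _ "- n"])
  moreover have "same_point (q T) q1" using opt by (simp add: solves_elastic_problem_def)
  ultimately have "same_point (trajectory w T) q1"
    using w(2) unfolding same_point_def by (metis rcong_trans)
  then have "elastic_energy T c \<le> elastic_energy T w"
    using opt trajectory_admissible[OF w(1)] unfolding solves_elastic_problem_def by blast
  with w(3) E show False by simp
qed

lemma integral_reverse:
  fixes f :: "real \<Rightarrow> real"
  assumes "continuous_on UNIV f"
  shows "integral {a..b} (\<lambda>s. f (t - s)) = integral {t - b..t - a} f"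
proof -
  have "(f has_integral integral {t - b..t - a} f) (cbox (t - b) (t - a))"
    unfolding cbox_interval
    by (intro integrable_integral integrable_continuous_interval continuous_on_subset[OF assms]) simp
  from has_integral_affinity[OF this, of "- 1" t]
  have "((\<lambda>s. f (t - s)) has_integral integral {t - b..t - a} f) ((\<lambda>x. t - x) ` {t - b..t - a})"
    by simp
  also have "(\<lambda>x. t - x) ` {t - b..t - a} = {a..b}" by simp
  finally show ?thesis by (rule integral_unique)
qed

lemma heading_reverse:
  assumes c: "continuous_on UNIV c" and s: "0 \<le> s" "s \<le> t"
  shows "heading (\<lambda>s. \<epsilon> * c (t - s)) s = \<epsilon> * (heading c t - heading c (t - s))"
proof -
  have "integral {0..t} c = integral {0..t - s} c + integral {t - s..t} c"
    using s integrable_continuous_interval[OF continuous_on_subset[OF c]]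
    by (subst Henstock_Kurzweil_Integration.integral_combine) auto
  then show ?thesis using integral_reverse[OF c, of 0 s t] by (simp add: heading_def)
qed

lemma reversal_maxwell:
  assumes c: "continuous_on UNIV c" and t: "0 < t" "t < T" and \<epsilon>: "\<bar>\<epsilon>\<bar> = 1"
    and x: "integral {0..t} (\<lambda>s. cos (\<epsilon> * (heading c t - heading c s))) = integral {0..t} (\<lambda>s. cos (heading c s))"
    and y: "integral {0..t} (\<lambda>s. sin (\<epsilon> * (heading c t - heading c s))) = integral {0..t} (\<lambda>s. sin (heading c s))"
    and angle: "\<epsilon> * heading c t = heading c t + 2 * pi * of_int n"
    and jump: "\<epsilon> * c 0 \<noteq> c t"
  shows "\<not> solves_elastic_problem T q1 c q"
proof (rule maxwell_point_ends_optimality[OF c _ t, where b = "\<lambda>s. \<epsilon> * c (t - s)"])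
  show "continuous_on UNIV (\<lambda>s. \<epsilon> * c (t - s))"
    by (intro continuous_on_mult continuous_on_const continuous_on_compose2[OF c]
        continuous_on_diff continuous_on_id) simp
  have "\<epsilon>\<^sup>2 = 1" using \<epsilon> by (metis power2_abs one_power2)
  then show "integral {0..t} (\<lambda>s. (\<epsilon> * c (t - s))\<^sup>2) = integral {0..t} (\<lambda>s. (c s)\<^sup>2)"
    using integral_reverse[OF continuous_on_power[OF c, of 2], of 0 t t] by (simp add: power_mult_distrib)
  have hc: "continuous_on UNIV (\<lambda>s. \<epsilon> * (heading c t - heading c s))"
    by (intro continuous_on_mult continuous_on_const continuous_on_diff continuous_heading c)
  have "integral {0..t} (\<lambda>s. cos (heading (\<lambda>s. \<epsilon> * c (t - s)) s))
      = integral {0..t} (\<lambda>s. cos (\<epsilon> * (heading c t - heading c (t - s))))"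
    by (rule integral_cong) (simp add: heading_reverse[OF c])
  also have "\<dots> = integral {0..t} (\<lambda>s. cos (\<epsilon> * (heading c t - heading c s)))"
    using integral_reverse[OF continuous_on_cos[OF hc], of 0 t t] by simp
  finally show "integral {0..t} (\<lambda>s. cos (heading (\<lambda>s. \<epsilon> * c (t - s)) s))
      = integral {0..t} (\<lambda>s. cos (heading c s))" using x by simp
  have "integral {0..t} (\<lambda>s. sin (heading (\<lambda>s. \<epsilon> * c (t - s)) s))
      = integral {0..t} (\<lambda>s. sin (\<epsilon> * (heading c t - heading c (t - s))))"
    by (rule integral_cong) (simp add: heading_reverse[OF c])
  also have "\<dots> = integral {0..t} (\<lambda>s. sin (\<epsilon> * (heading c t - heading c s)))"
    using integral_reverse[OF continuous_on_sin[OF hc], of 0 t t] by simp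
  finally show "integral {0..t} (\<lambda>s. sin (heading (\<lambda>s. \<epsilon> * c (t - s)) s))
      = integral {0..t} (\<lambda>s. sin (heading c s))" using y by simp
  show "heading (\<lambda>s. \<epsilon> * c (t - s)) t = heading c t + 2 * pi * of_int n"
    using heading_reverse[OF c, of t t] t angle by simp
  show "\<epsilon> * c (t - t) \<noteq> c t" using jump by simp
qed

text \<open>
  The control $-c(t-s)$ has the heading $\theta_{t-s} - \theta_t$.  Its curve is the image of the original one under
  the half turn about the middle of the chord, followed from the other end and rotated by $-\theta_t$; here this
  rotation is trivial, so both curves have the same chord.
\<close>
lemma closed_turn_maxwell:
  assumes c: "continuous_on UNIV c" and t: "0 < t" "t < T"
    and turn: "heading c t = 2 * pi * of_int n" and jump: "c 0 + c t \<noteq> 0"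
  shows "\<not> solves_elastic_problem T q1 c q"
proof (rule reversal_maxwell[OF c t, where \<epsilon> = "- 1" and n = "- 2 * n"])
  have "cos (heading c s - heading c t) = cos (heading c s)" "sin (heading c s - heading c t) = sin (heading c s)" for s
    by (simp_all add: turn cos_diff sin_diff)
  then show "integral {0..t} (\<lambda>s. cos (- 1 * (heading c t - heading c s))) = integral {0..t} (\<lambda>s. cos (heading c s))"
    "integral {0..t} (\<lambda>s. sin (- 1 * (heading c t - heading c s))) = integral {0..t} (\<lambda>s. sin (heading c s))"
    by simp_all
qed (use turn jump in auto)

text \<open>
  The control $c(t-s)$ has the heading $\theta_t - \theta_{t-s}$, and its chord is that of $c$ reflected in the
  direction $\theta_t/2$.  The chord is unchanged exactly when it points along this direction.
\<close>
lemma symmetric_arc_maxwell: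
  assumes c: "continuous_on UNIV c" and t: "0 < t" "t < T"
    and chord: "integral {0..t} (\<lambda>s. sin (heading c s - heading c t / 2)) = 0" and jump: "c 0 \<noteq> c t"
  shows "\<not> solves_elastic_problem T q1 c q"
proof (rule reversal_maxwell[OF c t, where \<epsilon> = 1 and n = 0])
  define h where "h = heading c t / 2"
  define X where "X = integral {0..t} (\<lambda>s. cos (heading c s))"
  define Y where "Y = integral {0..t} (\<lambda>s. sin (heading c s))"
  have int: "(\<lambda>s. cos (heading c s)) integrable_on {0..t}" "(\<lambda>s. sin (heading c s)) integrable_on {0..t}"
    by (intro integrable_continuous_interval continuous_on_cos continuous_on_sin continuous_heading c)+
  have "(\<lambda>s. sin (heading c s - h)) = (\<lambda>s. (- sin h) * cos (heading c s) + cos h * sin (heading c s))"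
    by (simp add: sin_diff fun_eq_iff)
  then have chord': "cos h * Y = sin h * X"
    using chord integral_lincomb[OF int, of "- sin h" "cos h"] by (simp add: h_def X_def Y_def)
  have d: "heading c t = 2 * h" by (simp add: h_def)
  have "(\<lambda>s. cos (heading c t - heading c s)) = (\<lambda>s. cos (2 * h) * cos (heading c s) + sin (2 * h) * sin (heading c s))"
    by (simp add: d cos_diff)
  then have "integral {0..t} (\<lambda>s. cos (heading c t - heading c s)) = cos (2 * h) * X + sin (2 * h) * Y"
    by (simp only: integral_lincomb[OF int] X_def Y_def)
  also have "\<dots> = X"
    using chord' sin_cos_squared_add[of h] unfolding cos_double sin_double by algebra
  finally show "integral {0..t} (\<lambda>s. cos (1 * (heading c t - heading c s))) = integral {0..t} (\<lambda>s. cos (heading c s))"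
    by (simp add: X_def)
  have "(\<lambda>s. sin (heading c t - heading c s)) = (\<lambda>s. sin (2 * h) * cos (heading c s) + (- cos (2 * h)) * sin (heading c s))"
    by (simp add: d sin_diff)
  then have "integral {0..t} (\<lambda>s. sin (heading c t - heading c s)) = sin (2 * h) * X + (- cos (2 * h)) * Y"
    by (simp only: integral_lincomb[OF int] X_def Y_def)
  also have "\<dots> = Y"
    using chord' sin_cos_squared_add[of h] unfolding cos_double sin_double by algebra
  finally show "integral {0..t} (\<lambda>s. sin (1 * (heading c t - heading c s))) = integral {0..t} (\<lambda>s. sin (heading c s))"
    by (simp add: Y_def)
qed (use jump in auto)

section \<open>The pendulum and the cut time\<close>

lemma normal_extremalE:
  assumes "normal_extremal (\<beta>0, c0, r) c q"
  obtains \<beta> where "\<beta> 0 = \<beta>0" "c 0 = c0"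
    "\<And>s. (\<beta> has_real_derivative c s) (at s)"
    "\<And>s. (c has_real_derivative - r * sin (\<beta> s)) (at s)"
    "continuous_on UNIV c"
    "\<And>s. 0 \<le> s \<Longrightarrow> heading c s = \<beta> s - \<beta>0"
proof -
  obtain \<beta> where \<beta>: "\<beta> 0 = \<beta>0" "c 0 = c0" "\<And>s. (\<beta> has_real_derivative c s) (at s)"
    "\<And>s. (c has_real_derivative - r * sin (\<beta> s)) (at s)"
    using assms unfolding normal_extremal_def by auto
  have c: "continuous_on UNIV c"
    using \<beta>(4) by (meson DERIV_isCont continuous_at_imp_continuous_on)
  have "heading c s = \<beta> s - \<beta>0" if "0 \<le> s" for s
  proof -
    have "(c has_integral \<beta> s - \<beta> 0) {0..s}"
      by (rule fundamental_theorem_of_calculus[OF that])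
         (use \<beta>(3) in \<open>auto simp: has_real_derivative_iff_has_vector_derivative intro: has_vector_derivative_at_within\<close>)
    then show ?thesis by (simp add: heading_def integral_unique \<beta>(1))
  qed
  with \<beta> c that show thesis by blast
qed

lemma pendulum_energy_conserved:
  fixes \<beta> c :: "real \<Rightarrow> real"
  assumes "\<And>s. (\<beta> has_real_derivative c s) (at s)" "\<And>s. (c has_real_derivative - r * sin (\<beta> s)) (at s)"
  shows "(c s)\<^sup>2 / 2 - r * cos (\<beta> s) = (c 0)\<^sup>2 / 2 - r * cos (\<beta> 0)"
proof (rule has_real_derivative_zero_imp_const[where f = "\<lambda>s. (c s)\<^sup>2 / 2 - r * cos (\<beta> s)"])
  show "((\<lambda>s. (c s)\<^sup>2 / 2 - r * cos (\<beta> s)) has_real_derivative 0) (at s)" for s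
    by (auto intro!: derivative_eq_intros assms)
qed

text \<open>
  A Gronwall argument for the squared distance $D$ of two solutions in the phase plane: the sine is
  1-Lipschitz, hence $D' \<le> (1 + r) D$.
\<close>
lemma pendulum_unique:
  fixes \<beta> c b d :: "real \<Rightarrow> real"
  assumes r: "0 \<le> r"
    and 1: "\<And>s. (\<beta> has_real_derivative c s) (at s)" "\<And>s. (c has_real_derivative - r * sin (\<beta> s)) (at s)"
    and 2: "\<And>s. (b has_real_derivative d s) (at s)" "\<And>s. (d has_real_derivative - r * sin (b s)) (at s)"
    and init: "\<beta> 0 = b 0" "c 0 = d 0" and s: "0 \<le> s"
  shows "\<beta> s = b s" "c s = d s"
proof -
  define D where "D s = (\<beta> s - b s)\<^sup>2 + (c s - d s)\<^sup>2" for s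
  \<comment> \<open>The weight makes the Gronwall bound the monotonicity of a product.\<close>
  define G where "G s = exp (- (1 + r) * s) * D s" for s
  have "G s \<le> G 0"
  proof (rule DERIV_nonpos_imp_nonincreasing[OF s])
    fix x
    let ?D' = "2 * (\<beta> x - b x) * (c x - d x) + 2 * (c x - d x) * (- r * sin (\<beta> x) - - r * sin (b x))"
    have D: "(D has_real_derivative ?D') (at x)"
      unfolding D_def[abs_def] by (rule DERIV_cong, (rule derivative_eq_intros 1 2 refl)+) (simp add: algebra_simps)
    have "(G has_real_derivative exp (- (1 + r) * x) * ?D' + - (1 + r) * exp (- (1 + r) * x) * D x) (at x)"
      unfolding G_def[abs_def] by (rule DERIV_cong, (rule derivative_eq_intros D refl)+) (simp add: algebra_simps)
    moreover have "?D' \<le> (1 + r) * D x"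
    proof -
      have "\<bar>sin (\<beta> x) - sin (b x)\<bar> \<le> \<bar>\<beta> x - b x\<bar>"
        using abs_cos_diff_le[of "\<beta> x - pi / 2" "b x - pi / 2"] by (simp add: cos_diff)
      then have "\<bar>c x - d x\<bar> * \<bar>sin (\<beta> x) - sin (b x)\<bar> \<le> \<bar>c x - d x\<bar> * \<bar>\<beta> x - b x\<bar>"
        by (intro mult_left_mono) auto
      moreover have am: "2 * (\<bar>c x - d x\<bar> * \<bar>\<beta> x - b x\<bar>) \<le> D x"
        using sum_squares_bound[of "\<bar>\<beta> x - b x\<bar>" "\<bar>c x - d x\<bar>"] by (simp add: D_def mult_ac)
      ultimately have "2 * (\<bar>c x - d x\<bar> * \<bar>sin (\<beta> x) - sin (b x)\<bar>) \<le> D x" by linarith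
      then have "r * (2 * (\<bar>c x - d x\<bar> * \<bar>sin (\<beta> x) - sin (b x)\<bar>)) \<le> r * D x"
        using r by (rule mult_left_mono)
      moreover have "2 * (c x - d x) * (- r * sin (\<beta> x) - - r * sin (b x))
        \<le> r * (2 * (\<bar>c x - d x\<bar> * \<bar>sin (\<beta> x) - sin (b x)\<bar>))"
      proof -
        have "2 * (c x - d x) * (- r * sin (\<beta> x) - - r * sin (b x)) = r * (2 * - ((c x - d x) * (sin (\<beta> x) - sin (b x))))"
          by (simp add: algebra_simps)
        also have "\<dots> \<le> r * (2 * (\<bar>c x - d x\<bar> * \<bar>sin (\<beta> x) - sin (b x)\<bar>))"
          using r abs_ge_minus_self[of "(c x - d x) * (sin (\<beta> x) - sin (b x))"]
          by (intro mult_left_mono) (simp_all add: abs_mult)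
        finally show ?thesis .
      qed
      moreover have "2 * (\<beta> x - b x) * (c x - d x) \<le> 2 * (\<bar>c x - d x\<bar> * \<bar>\<beta> x - b x\<bar>)"
      proof -
        have "(\<beta> x - b x) * (c x - d x) \<le> \<bar>c x - d x\<bar> * \<bar>\<beta> x - b x\<bar>"
          by (metis abs_ge_self abs_mult mult.commute)
        then show ?thesis by (simp only: mult.assoc)
      qed
      ultimately show ?thesis using am by (simp add: algebra_simps)
    qed
    then have "exp (- (1 + r) * x) * (?D' - (1 + r) * D x) \<le> 0"
      by (intro mult_nonneg_nonpos) auto
    ultimately show "\<exists>y. (G has_real_derivative y) (at x) \<and> y \<le> 0"
      by (intro exI conjI) (auto simp: algebra_simps)
  qed
  then have "exp (- (1 + r) * s) * D s \<le> 0" by (simp add: G_def D_def init)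
  then have "D s \<le> 0" by (simp add: mult_le_0_iff)
  then have "(\<beta> s - b s)\<^sup>2 = 0 \<and> (c s - d s)\<^sup>2 = 0"
    using zero_le_power2[of "\<beta> s - b s"] zero_le_power2[of "c s - d s"] unfolding D_def by linarith
  then show "\<beta> s = b s" "c s = d s" by simp_all
qed

lemma t_cut_leI:
  assumes "\<And>c q t1. normal_extremal l c q \<Longrightarrow> t < t1 \<Longrightarrow> \<not> solves_elastic_problem t1 (q t1) c q"
  shows "t_cut l \<le> ennreal t"
  unfolding t_cut_def
proof (rule Sup_least)
  fix x assume "x \<in> {ennreal t1 | t1. t1 > 0 \<and>
     (\<exists>c q. normal_extremal l c q \<and> solves_elastic_problem t1 (q t1) c q)}"
  then obtain t1 c q where "x = ennreal t1" "normal_extremal l c q" "solves_elastic_problem t1 (q t1) c q"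
    by blast
  moreover from this have "t1 \<le> t" using assms[of c q t1] by (meson not_less)
  ultimately show "x \<le> ennreal t" by (simp add: ennreal_leI)
qed

lemma circle_cut_time:
  assumes "c0 \<noteq> 0"
  shows "t_cut (\<beta>0, c0, 0) \<le> ennreal (2 * pi / \<bar>c0\<bar>)"
proof (rule t_cut_leI)
  fix c q t1 assume ext: "normal_extremal (\<beta>0, c0, 0) c q" and t1: "2 * pi / \<bar>c0\<bar> < t1"
  obtain \<beta> where \<beta>: "\<beta> 0 = \<beta>0" "c 0 = c0" "\<And>s. (\<beta> has_real_derivative c s) (at s)"
    "\<And>s. (c has_real_derivative - 0 * sin (\<beta> s)) (at s)" "continuous_on UNIV c"
    by (rule normal_extremalE[OF ext]) (rule that; assumption)
  have "c s = c0" for s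
    using has_real_derivative_zero_imp_const[of c s 0] \<beta>(2,4) by simp
  then have c: "c = (\<lambda>_. c0)" by auto
  show "\<not> solves_elastic_problem t1 (q t1) c q"
  proof (rule closed_turn_maxwell[OF \<beta>(5) _ t1, where n = "if c0 > 0 then 1 else - 1"])
    show "heading c (2 * pi / \<bar>c0\<bar>) = 2 * pi * of_int (if c0 > 0 then 1 else - 1)"
      using assms by (auto simp: heading_def c abs_if field_simps)
  qed (use assms c in auto)
qed

text \<open>
  With $k^2 = 2r/(E+r)$ the energy integral reads $c^2 = 2(E+r)(1 - k^2 \sin^2(\beta/2))$.  So
  $F(\beta/2)$ has the constant speed $\pm\sqrt r / k$ and gains $\pm 2K$ in time $2kK/\sqrt r$, which is
  a full turn of $\beta$.
\<close>
lemma rotating_cut_time: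
  assumes l: "(\<beta>0, c0, r) \<in> N2"
  defines "k \<equiv> modulus2 (\<beta>0, c0, r)"
  shows "t_cut (\<beta>0, c0, r) \<le> ennreal (2 * k / sqrt r * ell_K k)"
proof (rule t_cut_leI)
  fix c q t1 assume ext: "normal_extremal (\<beta>0, c0, r) c q" and t1: "2 * k / sqrt r * ell_K k < t1"
  obtain \<beta> where \<beta>: "\<beta> 0 = \<beta>0" "c 0 = c0" "\<And>s. (\<beta> has_real_derivative c s) (at s)"
    "\<And>s. (c has_real_derivative - r * sin (\<beta> s)) (at s)" "continuous_on UNIV c"
    "\<And>s. 0 \<le> s \<Longrightarrow> heading c s = \<beta> s - \<beta>0"
    by (rule normal_extremalE[OF ext]) (rule that; assumption)
  define e where "e = pend_energy (\<beta>0, c0, r)"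
  have r: "0 < r" "r < e" using l by (auto simp: N2_def e_def)
  have k2: "k\<^sup>2 = 2 * r / (e + r)" using r by (simp add: k_def modulus2_def e_def)
  have ek: "(e + r) * k\<^sup>2 = 2 * r" using r by (simp add: k2)
  have k: "0 < k" "k < 1" using r by (auto simp: k_def modulus2_def e_def[symmetric])
  define t where "t = 2 * k / sqrt r * ell_K k"
  have t: "0 < t" using k r ell_K_pos[OF k] by (simp add: t_def)
  have en: "(c s)\<^sup>2 = 2 * (e + r) * (1 - k\<^sup>2 * (sin (\<beta> s / 2))\<^sup>2)" for s
  proof -
    have "(c s)\<^sup>2 = 2 * (e + r * cos (\<beta> s))"
      using pendulum_energy_conserved[of \<beta> c r s, OF \<beta>(3,4)] \<beta>(1,2) by (simp add: e_def pend_energy_def)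
    also have "cos (\<beta> s) = 1 - 2 * (sin (\<beta> s / 2))\<^sup>2" using cos_double_sin[of "\<beta> s / 2"] by simp
    finally show ?thesis using ek by algebra
  qed
  have pos: "0 < 1 - k\<^sup>2 * (sin x)\<^sup>2" for x by (rule radicand_pos[OF k])
  have c0: "c s \<noteq> 0" for s using en[of s] pos[of "\<beta> s / 2"] r by auto
  \<comment> \<open>Above the separatrix energy the angular velocity never vanishes, so it keeps its sign.\<close>
  have sign: "sgn (c s) = sgn (c 0)" for s
  proof (rule ccontr)
    assume "sgn (c s) \<noteq> sgn (c 0)"
    then have "0 \<in> closed_segment (c 0) (c s)" using c0[of s] c0[of 0]
      by (auto simp: closed_segment_eq_real_ivl sgn_if split: if_splits)
    moreover have "connected (range c)" by (rule connected_continuous_image[OF \<beta>(5) connected_UNIV])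
    from connected_contains_Icc[OF this rangeI rangeI, of 0 s] connected_contains_Icc[OF this rangeI rangeI, of s 0]
    have "closed_segment (c 0) (c s) \<subseteq> range c" by (simp add: closed_segment_eq_real_ivl)
    ultimately have "0 \<in> range c" by blast
    with c0 show False by (metis imageE)
  qed
  define \<sigma> where "\<sigma> = sgn (c 0)"
  have cs: "c s / 2 = \<sigma> * (sqrt r / k) * sqrt (1 - k\<^sup>2 * (sin (\<beta> s / 2))\<^sup>2)" for s
  proof -
    have "\<bar>c s\<bar> / 2 = sqrt ((c s)\<^sup>2 / 4)" by (simp add: real_sqrt_divide)
    also have "(c s)\<^sup>2 / 4 = r / k\<^sup>2 * (1 - k\<^sup>2 * (sin (\<beta> s / 2))\<^sup>2)"
      unfolding en using r by (simp add: k2)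
    also have "sqrt \<dots> = sqrt r / k * sqrt (1 - k\<^sup>2 * (sin (\<beta> s / 2))\<^sup>2)"
      using k by (simp add: real_sqrt_mult real_sqrt_divide)
    finally show ?thesis using sgn_mult_abs[of "c s"] unfolding \<sigma>_def sign[of s, symmetric]
      by (simp add: mult.assoc)
  qed
  have "((\<lambda>s. ell_F k (\<beta> s / 2) - \<sigma> * (sqrt r / k) * s) has_real_derivative 0) (at s)" for s
  proof -
    have "((\<lambda>s. \<beta> s / 2) has_real_derivative c s / 2) (at s)"
      by (auto intro!: derivative_eq_intros \<beta>)
    from DERIV_chain2[OF ell_F_has_derivative[OF k] this]
    have "((\<lambda>s. ell_F k (\<beta> s / 2)) has_real_derivative \<sigma> * (sqrt r / k)) (at s)"
      unfolding cs using k pos[of "\<beta> s / 2"] by simp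
    then show ?thesis using k by (auto intro!: derivative_eq_intros)
  qed
  from has_real_derivative_zero_imp_const[OF this, of t 0]
  have F: "ell_F k (\<beta> t / 2) = ell_F k (\<beta>0 / 2) + \<sigma> * (2 * ell_K k)"
    using k r by (simp add: \<beta>(1) t_def)
  have inj: "ell_F k x = ell_F k y \<Longrightarrow> x = y" for x y using am_ell_F[OF k] by metis
  have \<sigma>: "\<sigma> = 1 \<or> \<sigma> = - 1" using c0[of 0] by (simp add: \<sigma>_def sgn_if)
  have "\<beta> t / 2 = \<beta>0 / 2 + \<sigma> * pi"
    using \<sigma> F inj[of "\<beta> t / 2" "\<beta>0 / 2 + pi"] inj[of "\<beta> t / 2 + pi" "\<beta>0 / 2"]
      ell_F_add_pi[OF k, of "\<beta>0 / 2"] ell_F_add_pi[OF k, of "\<beta> t / 2"] by auto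
  then have turn: "\<beta> t - \<beta>0 = 2 * pi * \<sigma>" by simp
  show "\<not> solves_elastic_problem t1 (q t1) c q"
  proof (rule closed_turn_maxwell[OF \<beta>(5) t, where n = "if \<sigma> = 1 then 1 else - 1"])
    show "t < t1" using t1 by (simp add: t_def)
    show "heading c t = 2 * pi * of_int (if \<sigma> = 1 then 1 else - 1)" using turn \<sigma> t \<beta>(6) by auto
    show "c 0 + c t \<noteq> 0" using sign[of t] c0[of 0] c0[of t] by (auto simp: sgn_if split: if_splits)
  qed
qed

lemma modulus1_in_unit_interval:
  assumes "(\<beta>0, c0, r) \<in> N1"
  shows "0 < modulus1 (\<beta>0, c0, r)" "modulus1 (\<beta>0, c0, r) < 1"
  using assms by (auto simp: N1_def modulus1_def)

text \<open>
  The solution of the pendulum equation with amplitude $2 \arcsin k$; its representative lies in $(-\pi,\pi)$.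
\<close>
definition pendulum_angle :: "real \<Rightarrow> real \<Rightarrow> real \<Rightarrow> real \<Rightarrow> real" where
  "pendulum_angle r k \<phi> s = 2 * arcsin (k * jacobi_sn k (sqrt r * (\<phi> + s)))"

lemma oscillating_solution:
  fixes \<phi> :: real
  assumes r: "0 < r" and k: "0 < k" "k < 1"
  defines "B \<equiv> pendulum_angle r k \<phi>"
    and "C \<equiv> \<lambda>s. 2 * k * sqrt r * jacobi_cn k (sqrt r * (\<phi> + s))"
  shows "sin (B s / 2) = k * jacobi_sn k (sqrt r * (\<phi> + s))"
    and "cos (B s / 2) = jacobi_dn k (sqrt r * (\<phi> + s))"
    and "(B has_real_derivative C s) (at s)"
    and "(C has_real_derivative - r * sin (B s)) (at s)"
proof -
  have bnd: "(k * jacobi_sn k x)\<^sup>2 < 1" for x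
    using radicand_pos[OF k, of "jacobi_am k x"] by (simp add: jacobi_sn_def power_mult_distrib)
  then have bnd': "- 1 < k * jacobi_sn k x" "k * jacobi_sn k x < 1" for x
    using abs_square_less_1[of "k * jacobi_sn k x"] by (auto simp: abs_less_iff)
  define \<tau> where "\<tau> s = sqrt r * (\<phi> + s)" for s
  have \<tau>: "(\<tau> has_real_derivative sqrt r) (at s)" for s
    unfolding \<tau>_def[abs_def] by (auto intro!: derivative_eq_intros)
  have B: "B = (\<lambda>s. 2 * arcsin (k * jacobi_sn k (\<tau> s)))" and C: "C = (\<lambda>s. 2 * k * sqrt r * jacobi_cn k (\<tau> s))"
    by (simp_all add: B_def pendulum_angle_def[abs_def] C_def \<tau>_def)
  show sinB: "sin (B s / 2) = k * jacobi_sn k (sqrt r * (\<phi> + s))" for s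
    using bnd'[of "\<tau> s"] by (simp add: B \<tau>_def[symmetric])
  show cosB: "cos (B s / 2) = jacobi_dn k (sqrt r * (\<phi> + s))" for s
    using bnd'[of "\<tau> s"] by (simp add: B \<tau>_def[symmetric] cos_arcsin jacobi_dn_def power_mult_distrib)
  have sq: "sqrt (1 - (k * jacobi_sn k x)\<^sup>2) = jacobi_dn k x" for x
    by (simp add: jacobi_dn_def power_mult_distrib)
  show "(B has_real_derivative C s) (at s)"
  proof -
    have "((\<lambda>s. k * jacobi_sn k (\<tau> s)) has_real_derivative k * (jacobi_cn k (\<tau> s) * jacobi_dn k (\<tau> s) * sqrt r)) (at s)"
      by (rule DERIV_cmult[OF DERIV_chain2[OF sn_has_derivative[OF k] \<tau>]])
    from DERIV_cmult[OF DERIV_chain2[OF DERIV_arcsin[OF bnd'] this], of 2]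
    show ?thesis using dn_pos[OF k, of "\<tau> s"] by (simp add: B C sq mult_ac)
  qed
  have "sin (B s) = 2 * (k * jacobi_sn k (\<tau> s)) * jacobi_dn k (\<tau> s)"
    using sin_double[of "B s / 2"] sinB[of s] cosB[of s] by (simp add: \<tau>_def)
  moreover have "(C has_real_derivative 2 * k * sqrt r * (- jacobi_sn k (\<tau> s) * jacobi_dn k (\<tau> s) * sqrt r)) (at s)"
    unfolding C by (rule DERIV_cmult[OF DERIV_chain2[OF cn_has_derivative[OF k] \<tau>]])
  moreover have "2 * k * sqrt r * (- jacobi_sn k (\<tau> s) * jacobi_dn k (\<tau> s) * sqrt r)
     = - (sqrt r)\<^sup>2 * (2 * (k * jacobi_sn k (\<tau> s)) * jacobi_dn k (\<tau> s))"
    by (simp only: power2_eq_square mult_ac minus_mult_left minus_mult_right)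
  then have "2 * k * sqrt r * (- jacobi_sn k (\<tau> s) * jacobi_dn k (\<tau> s) * sqrt r)
     = - r * (2 * (k * jacobi_sn k (\<tau> s)) * jacobi_dn k (\<tau> s))"
    using r by (simp only: real_sqrt_pow2 less_imp_le)
  ultimately show "(C has_real_derivative - r * sin (B s)) (at s)" by (simp only:)
qed

text \<open>
  The elliptic coordinate fixes $\beta$ only up to a multiple of $2\pi$, which cancels in the heading.
\<close>
lemma oscillating_extremal:
  assumes l: "(\<beta>0, c0, r) \<in> N1" and \<phi>: "elliptic_coord (\<beta>0, c0, r) \<phi>"
    and ext: "normal_extremal (\<beta>0, c0, r) c q"
  defines "k \<equiv> modulus1 (\<beta>0, c0, r)"
  defines "B \<equiv> pendulum_angle r k \<phi>"
  assumes s: "0 \<le> s"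
  shows "heading c s = B s - B 0" "c s = 2 * k * sqrt r * jacobi_cn k (sqrt r * (\<phi> + s))"
proof -
  have r: "0 < r" using l by (simp add: N1_def)
  have k: "0 < k" "k < 1" using modulus1_in_unit_interval[OF l] by (simp_all add: k_def)
  note sol = oscillating_solution[OF r k, of \<phi>, folded B_def]
  obtain b where b: "- pi < b" "b < pi" "[b = \<beta>0] (rmod (2 * pi))"
    "sin (b / 2) = k * jacobi_sn k (sqrt r * \<phi>)" "c0 / 2 = k * sqrt r * jacobi_cn k (sqrt r * \<phi>)"
    using \<phi> unfolding elliptic_coord_def k_def by auto
  obtain n where n: "\<beta>0 = b + of_int n * (2 * pi)" using b(3) by (auto simp: rcong_altdef)
  have "b = B 0" using b(1,2) arcsin_sin[of "b / 2"] by (simp add: B_def pendulum_angle_def b(4)[symmetric])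
  obtain \<beta> where \<beta>: "\<beta> 0 = \<beta>0" "c 0 = c0" "\<And>s. (\<beta> has_real_derivative c s) (at s)"
    "\<And>s. (c has_real_derivative - r * sin (\<beta> s)) (at s)" "continuous_on UNIV c"
    "\<And>s. 0 \<le> s \<Longrightarrow> heading c s = \<beta> s - \<beta>0"
    by (rule normal_extremalE[OF ext]) (rule that; assumption)
  define b' where "b' s = B s + of_int n * (2 * pi)" for s
  have b': "(b' has_real_derivative 2 * k * sqrt r * jacobi_cn k (sqrt r * (\<phi> + s))) (at s)" for s
    unfolding b'_def[abs_def] using DERIV_add[OF sol(3) DERIV_const] by simp
  have sb: "sin (b' s) = sin (B s)" for s
    using sin_cos_eq_iff[of "b' s" "B s"] by (auto simp: b'_def mult_ac)
  have d': "((\<lambda>s. 2 * k * sqrt r * jacobi_cn k (sqrt r * (\<phi> + s))) has_real_derivative - r * sin (b' s)) (at s)" for s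
    using sol(4)[of s] by (simp only: sb)
  have "\<beta> 0 = b' 0" "c 0 = 2 * k * sqrt r * jacobi_cn k (sqrt r * (\<phi> + 0))"
    using \<beta>(1,2) n b(5) \<open>b = B 0\<close> by (simp_all add: b'_def)
  from pendulum_unique[OF less_imp_le[OF r] \<beta>(3,4) b' d' this s]
  have "\<beta> s = b' s \<and> c s = 2 * k * sqrt r * jacobi_cn k (sqrt r * (\<phi> + s))" by blast
  then show "heading c s = B s - B 0" "c s = 2 * k * sqrt r * jacobi_cn k (sqrt r * (\<phi> + s))"
    using \<beta>(6)[OF s] n \<open>b = B 0\<close> by (auto simp: b'_def)
qed

text \<open>
  The integrand has an explicit primitive, since $\sin B = 2k\,\mathrm{sn}\,\mathrm{dn}$ and
  $\cos B = 2\mathrm{dn}^2 - 1$; its increment is the quantity that \<open>inflectional_chord\<close> shows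
  to be zero.
\<close>
lemma oscillating_chord:
  fixes \<phi> :: real
  assumes r: "0 < r" and k: "0 < k" "k < 1" and p: "0 < p" and root: "f1 p k = 0"
  defines "B \<equiv> pendulum_angle r k \<phi>"
    and "t \<equiv> 2 / sqrt r * p"
  shows "integral {0..t} (\<lambda>s. sin (B s - (B 0 + B t) / 2)) = 0"
proof -
  note sol = oscillating_solution[OF r k, of \<phi>, folded B_def]
  define \<tau> where "\<tau> s = sqrt r * (\<phi> + s)" for s
  define M where "M = (B 0 + B t) / 2"
  define G where "G s = (cos M * (- 2 * k * jacobi_cn k (\<tau> s)) - sin M * (2 * jacobi_E k (\<tau> s) - \<tau> s)) / sqrt r" for s
  have t: "0 \<le> t" using r p by (simp add: t_def)
  have \<tau>: "(\<tau> has_real_derivative sqrt r) (at s)" for s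
    unfolding \<tau>_def[abs_def] by (auto intro!: derivative_eq_intros)
  have sinB: "sin (B s) = 2 * k * jacobi_sn k (\<tau> s) * jacobi_dn k (\<tau> s)" for s
    using sin_double[of "B s / 2"] sol(1,2)[of s] by (simp add: \<tau>_def)
  have cosB: "cos (B s) = 2 * (jacobi_dn k (\<tau> s))\<^sup>2 - 1" for s
    using cos_double_cos[of "B s / 2"] sol(2)[of s] by (simp add: \<tau>_def)
  have "(G has_real_derivative sin (B s - M)) (at s)" for s
  proof -
    have "(G has_real_derivative (cos M * (- 2 * k * (- jacobi_sn k (\<tau> s) * jacobi_dn k (\<tau> s) * sqrt r))
       - sin M * (2 * ((jacobi_dn k (\<tau> s))\<^sup>2 * sqrt r) - sqrt r)) / sqrt r) (at s)"
      unfolding G_def[abs_def]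
      by (rule DERIV_cdivide DERIV_diff DERIV_cmult DERIV_chain2[OF cn_has_derivative[OF k]]
          DERIV_chain2[OF jacobi_E_has_derivative[OF k]] \<tau>)+
    also have "(cos M * (- 2 * k * (- jacobi_sn k (\<tau> s) * jacobi_dn k (\<tau> s) * sqrt r))
       - sin M * (2 * ((jacobi_dn k (\<tau> s))\<^sup>2 * sqrt r) - sqrt r)) / sqrt r = sin (B s - M)"
      using r by (simp add: sin_diff sinB cosB field_simps)
    finally show ?thesis .
  qed
  then have "((\<lambda>s. sin (B s - M)) has_integral G t - G 0) {0..t}"
    by (intro fundamental_theorem_of_calculus[OF t])
       (auto simp: has_real_derivative_iff_has_vector_derivative intro: has_vector_derivative_at_within)
  moreover have "G t = G 0"
  proof -
    \<comment> \<open>The time interval corresponds to $[m - p, m + p]$ in the elliptic coordinate.\<close>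
    define m where "m = sqrt r * \<phi> + p"
    have ends: "\<tau> 0 = m - p" "\<tau> t = m + p"
      using r by (simp_all add: \<tau>_def m_def t_def field_simps)
    have half: "sin (B 0 / 2) = k * jacobi_sn k (m - p)" "cos (B 0 / 2) = jacobi_dn k (m - p)"
      "sin (B t / 2) = k * jacobi_sn k (m + p)" "cos (B t / 2) = jacobi_dn k (m + p)"
      using sol(1,2)[of 0] sol(1,2)[of t] by (simp_all only: \<tau>_def[symmetric] ends)
    have M: "M = B 0 / 2 + B t / 2" by (simp add: M_def)
    have "cos M = jacobi_dn k (m + p) * jacobi_dn k (m - p) - k\<^sup>2 * jacobi_sn k (m + p) * jacobi_sn k (m - p)"
      "sin M = k * (jacobi_sn k (m + p) * jacobi_dn k (m - p) + jacobi_dn k (m + p) * jacobi_sn k (m - p))"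
      unfolding M cos_add sin_add half by (simp_all add: power2_eq_square algebra_simps)
    with inflectional_chord[OF k root, of m]
    have "cos M * (- 2 * k * (jacobi_cn k (m + p) - jacobi_cn k (m - p)))
      = sin M * (2 * (jacobi_E k (m + p) - jacobi_E k (m - p)) - 2 * p)" by simp
    then have "cos M * (- 2 * k * jacobi_cn k (\<tau> t)) - sin M * (2 * jacobi_E k (\<tau> t) - \<tau> t)
      = cos M * (- 2 * k * jacobi_cn k (\<tau> 0)) - sin M * (2 * jacobi_E k (\<tau> 0) - \<tau> 0)"
      unfolding ends by algebra
    then show ?thesis by (simp only: G_def)
  qed
  ultimately show ?thesis by (simp add: M_def integral_unique)
qed

lemma oscillating_cut_time:
  assumes l: "(\<beta>0, c0, r) \<in> N1" and \<phi>: "elliptic_coord (\<beta>0, c0, r) \<phi>"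
  defines "k \<equiv> modulus1 (\<beta>0, c0, r)"
  defines "t \<equiv> 2 / sqrt r * p1 k"
  assumes nz: "jacobi_cn k (sqrt r * (\<phi> + t / 2)) * jacobi_sn k (sqrt r * (\<phi> + t / 2)) \<noteq> 0"
  shows "t_cut (\<beta>0, c0, r) \<le> ennreal t"
proof (rule t_cut_leI)
  fix c q t1 assume ext: "normal_extremal (\<beta>0, c0, r) c q" and t1: "t < t1"
  have r: "0 < r" using l by (simp add: N1_def)
  have k: "0 < k" "k < 1" using modulus1_in_unit_interval[OF l] by (simp_all add: k_def)
  have p1: "0 < p1 k" using p11_is_root[OF k] ell_K_pos[OF k] by (simp add: p1_def)
  have t: "0 < t" using p1 r by (simp add: t_def)
  have c: "continuous_on UNIV c" by (rule normal_extremalE[OF ext])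
  define B where "B = pendulum_angle r k \<phi>"
  note sol = oscillating_extremal[OF l \<phi> ext, folded k_def, folded B_def]
  \<comment> \<open>The elliptic time of the midpoint, at which the hypothesis on cn and sn is imposed.\<close>
  define m where "m = sqrt r * \<phi> + p1 k"
  have mid: "sqrt r * (\<phi> + t / 2) = m" and ends: "sqrt r * \<phi> = m - p1 k" "sqrt r * (\<phi> + t) = m + p1 k"
    using r by (simp_all add: m_def t_def field_simps)
  have c_ends: "c 0 = 2 * k * sqrt r * jacobi_cn k (m - p1 k)" "c t = 2 * k * sqrt r * jacobi_cn k (m + p1 k)"
    using sol(2)[of 0] sol(2)[of t] t by (simp_all add: ends)
  show "\<not> solves_elastic_problem t1 (q t1) c q"
  proof (cases "2 * ell_K k \<le> p11 k")
    case True
    then have p: "p1 k = 2 * ell_K k" by (simp add: p1_def)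
    have am: "jacobi_am k (m + p1 k) = jacobi_am k m + pi" "jacobi_am k (m - p1 k) = jacobi_am k m - pi"
      using am_add_2K[OF k, of m] am_add_2K[OF k, of "m - p1 k"] by (simp_all add: p)
    have cn: "jacobi_cn k (m + p1 k) = - jacobi_cn k m" "jacobi_cn k (m - p1 k) = - jacobi_cn k m"
      and sn: "jacobi_sn k (m + p1 k) = jacobi_sn k (m - p1 k)"
      by (simp_all add: jacobi_cn_def jacobi_sn_def am cos_diff sin_diff)
    show ?thesis
    proof (rule closed_turn_maxwell[OF c t t1, where n = 0])
      have "B t = B 0" by (simp add: B_def pendulum_angle_def ends sn)
      then show "heading c t = 2 * pi * of_int 0" using sol(1)[of t] t by simp
      show "c 0 + c t \<noteq> 0" using nz k r by (simp add: c_ends cn mid)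
    qed
  next
    case False
    then have p: "p1 k = p11 k" "p1 k < 2 * ell_K k" by (simp_all add: p1_def)
    show ?thesis
    proof (rule symmetric_arc_maxwell[OF c t t1])
      have "integral {0..t} (\<lambda>s. sin (heading c s - heading c t / 2))
        = integral {0..t} (\<lambda>s. sin (B s - (B 0 + B t) / 2))"
        by (rule integral_cong) (use t in \<open>simp add: sol(1) field_simps\<close>)
      also have "\<dots> = 0"
        using oscillating_chord[OF r k p1, of \<phi>] p11_is_root[OF k] by (simp add: p B_def t_def)
      finally show "integral {0..t} (\<lambda>s. sin (heading c s - heading c t / 2)) = 0" .
      have "jacobi_cn k (m + p1 k) - jacobi_cn k (m - p1 k) \<noteq> 0"
        unfolding cn_diff[OF k]
        using nz sn_pos[OF k p1 p(2)] dn_pos[OF k, of m] dn_pos[OF k, of "p1 k"]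
          addition_denominator_pos[OF k, of m "p1 k"] by (simp add: mid)
      then show "c 0 \<noteq> c t" using k r by (simp add: c_ends)
    qed
  qed
qed

theorem theorem12p1:
  fixes \<beta> c r :: real and l :: covector
  assumes "l = (\<beta>, c, r)" and "l \<in> covectors"
    and "(l \<in> N1 \<and>
           (\<exists>\<phi>. elliptic_coord l \<phi> \<and>
              (let \<tau> = sqrt r * (\<phi> + enn2real (t_bound l) / 2)
               in jacobi_cn (modulus1 l) \<tau> * jacobi_sn (modulus1 l) \<tau> \<noteq> 0)))
         \<or> l \<in> covectors - N1"
  shows "t_cut l \<le> t_bound l"
proof -
  consider (osc) "l \<in> N1" | (rot) "l \<notin> N1" "l \<in> N2" | (circ) "l \<notin> N1" "l \<notin> N2" "l \<in> N6"
    | (inf) "l \<in> N3 \<union> N4 \<union> N5 \<union> N7"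
    using assms(2) covectors_partition by auto
  then show ?thesis
  proof cases
    case osc
    define t where "t = 2 / sqrt r * p1 (modulus1 l)"
    have bound: "t_bound l = ennreal t" using osc by (simp add: assms(1) t_bound_def t_def)
    have l: "(\<beta>, c, r) \<in> N1" using osc assms(1) by simp
    have r: "0 < r" using l by (simp add: N1_def)
    have k: "0 < modulus1 l" "modulus1 l < 1" using modulus1_in_unit_interval[OF l] assms(1) by simp_all
    have "0 \<le> t" using p11_is_root[OF k] ell_K_pos[OF k] r by (simp add: t_def p1_def)
    then have "enn2real (t_bound l) = t" by (simp add: bound)
    with assms(3) osc obtain \<phi> where "elliptic_coord l \<phi>"
      "jacobi_cn (modulus1 l) (sqrt r * (\<phi> + t / 2)) * jacobi_sn (modulus1 l) (sqrt r * (\<phi> + t / 2)) \<noteq> 0"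
      by (auto simp: Let_def)
    then show ?thesis
      using oscillating_cut_time[OF l, of \<phi>] unfolding bound by (simp add: assms(1) t_def)
  next
    case rot
    then show ?thesis using rotating_cut_time[of \<beta> c r] by (simp add: assms(1) t_bound_def)
  next
    case circ
    then have "r = 0" "c \<noteq> 0" by (simp_all add: assms(1) N6_def)
    with circ show ?thesis using circle_cut_time[of c \<beta>] by (simp add: assms(1) t_bound_def)
  next
    case inf
    then show ?thesis by (simp add: t_bound_infinite)
  qed
qed

end
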